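(* Let $A\subset\mathbb{N}$ be such that $$\Delta\coloneq\limsup_{x\to\infty}\frac{1}{\log\log x}\sum_{a\in A\cap[2,x]}\frac{1}{a\log a}$$ is positive. Then there exists a strictly increasing infinite divisibility chain $n_0\mid n_1\mid n_2\mid\cdots$ (with $n_0<n_1<n_2<\cdots$) of elements of $A$ such that $$\limsup_{x\to\infty}\frac{1}{\log\log x}\#\{i: n_i\le x\}\ge\Delta.$$
   Context: $\mathbb{N}=\{1,2,3,\dots\}$. (The element $1$, if in $A$, contributes nothing to the sum defining $\Delta$.) *)

theory Defs
  imports "HOL-Analysis.Analysis"
begin

definition Delta :: "nat set \<Rightarrow> ereal" where
  "Delta A = Limsup at_top (\<lambda>x::real. ereal ((\<Sum>a\<in>{a\<in>A. 2 \<le> a \<and> real a \<le> x}. 1 / (real a * ln (real a))) / ln (ln x)))"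

definition chain_density :: "(nat \<Rightarrow> nat) \<Rightarrow> ereal" where
  "chain_density n = Limsup at_top (\<lambda>x::real. ereal (real (card {i. real (n i) \<le> x}) / ln (ln x)))"

end

theory Submission
  imports Defs "HOL-Probability.Probability" "HOL-Number_Theory.Prime_Powers"
    "HOL-Real_Asymp.Real_Asymp"
begin

text \<open>
  Let \<Lambda> be the von Mangoldt function and put I(n) = \<integral> n^(-s) / \<zeta>(s) ds over s > 1, h(1) = 1 and
  h(n) = ln n * I(n). Integrating the derivative of m^(-s) / \<zeta>(s) gives
  \<Sum> \<Lambda>(q) I(mq) \<le> h(m), the sum being over q, so a random walk on the positive integers may
  jump from m to mq with probability \<Lambda>(q) I(mq) / h(m) and die with the remaining probability.
  Started at 1 it visits n with probability exactly h(n), because the \<Lambda>(q) with q dvd n add up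
  to ln n. Since \<zeta>(s) has a simple pole with residue 1 at s = 1, h(n) is 1 / (n ln n) up to a
  summable error. Hence the expected number of visits to elements of A up to k, divided by ln ln k,
  has upper limit at least Delta A, and by the reverse Fatou lemma some trajectory, which is a
  divisibility chain, does as well as the mean. To apply that lemma one counts only visits to
  integers with at most K ln ln k prime factors, which makes the counts deterministically bounded
  and costs O(1/K).
\<close>

section \<open>The zeta function on the real half-line s > 1\<close>

text \<open>The index may start at 0 because \<open>0 powr - s = 0\<close>.\<close>

definition zeta_real :: "real \<Rightarrow> real" where
  "zeta_real s = (\<Sum>n. real n powr - s)"

text \<open>This is -\<zeta>'(s); the sign makes every term nonnegative.\<close>

definition zeta_deriv :: "real \<Rightarrow> real" where
  "zeta_deriv s = (\<Sum>n. ln (real n) * real n powr - s)"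

lemma summable_zeta: "s > 1 \<Longrightarrow> summable (\<lambda>n. real n powr - s)"
  by (simp add: summable_real_powr_iff)

text \<open>Mean value theorem for y^(1-s) / (1-s) on [x, x+1]: the quotient equals z^(-s) for an
  intermediate z, and this power decreases in z.\<close>

lemma powr_telescope_bounds:
  fixes x s :: real
  assumes "x > 0" "s > 1"
  shows "(x + 1) powr - s \<le> (x powr (1 - s) - (x + 1) powr (1 - s)) / (s - 1)"
    and "(x powr (1 - s) - (x + 1) powr (1 - s)) / (s - 1) \<le> x powr - s"
proof -
  have "\<exists>z. x < z \<and> z < x + 1 \<and>
      - ((x + 1) powr (1 - s)) / (s - 1) - (- (x powr (1 - s)) / (s - 1)) = (x + 1 - x) * (z powr - s)"
  proof (rule MVT2)
    fix y assume "x \<le> y" "y \<le> x + 1"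
    then have "y > 0" using assms by simp
    have "((\<lambda>y. - (1 / (s - 1)) * y powr (1 - s)) has_real_derivative
        - (1 / (s - 1)) * ((1 - s) * y powr (1 - s - 1))) (at y)"
      by (intro DERIV_cmult has_real_derivative_powr \<open>y > 0\<close>)
    moreover have "- (1 / (s - 1)) * ((1 - s) * y powr (1 - s - 1)) = y powr - s"
      using assms by (simp add: field_simps)
    ultimately show "((\<lambda>y. - (y powr (1 - s)) / (s - 1)) has_real_derivative y powr - s) (at y)"
      by simp
  qed simp
  then obtain z where z: "x < z" "z < x + 1"
    "(x powr (1 - s) - (x + 1) powr (1 - s)) / (s - 1) = z powr - s"
    by (auto simp: diff_divide_distrib)
  show "(x + 1) powr - s \<le> (x powr (1 - s) - (x + 1) powr (1 - s)) / (s - 1)"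
    unfolding z(3) using z assms by (intro powr_mono2') auto
  show "(x powr (1 - s) - (x + 1) powr (1 - s)) / (s - 1) \<le> x powr - s"
    unfolding z(3) using z assms by (intro powr_mono2') auto
qed

text \<open>Sum \<open>powr_telescope_bounds\<close> over the positive integers, for the upper bound
  after splitting off the term 1. This is the quantitative form of the simple pole with residue
  1.\<close>

lemma zeta_real_bounds:
  assumes "s > 1"
  shows "1 / (s - 1) \<le> zeta_real s" "zeta_real s \<le> 1 + 1 / (s - 1)"
proof -
  let ?f = "\<lambda>n. real (Suc n) powr (1 - s) / (s - 1)"
  have "?f \<longlonglongrightarrow> 0"
    using assms by real_asymp
  from telescope_sums'[OF this]
  have tel: "(\<lambda>n. ?f n - ?f (Suc n)) sums (1 / (s - 1))" by simp
  have sm1: "summable (\<lambda>n. real (Suc n) powr - s)"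
    using summable_zeta[OF assms] by (subst summable_Suc_iff)
  then have sm2: "summable (\<lambda>n. real (Suc (Suc n)) powr - s)"
    by (subst (asm) summable_Suc_iff[symmetric])
  have z1: "zeta_real s = (\<Sum>n. real (Suc n) powr - s)"
    unfolding zeta_real_def by (subst suminf_split_head[OF summable_zeta[OF assms]]) simp
  have z2: "zeta_real s = 1 + (\<Sum>n. real (Suc (Suc n)) powr - s)"
    unfolding z1 by (subst suminf_split_head[OF sm1]) simp
  have le1: "?f n - ?f (Suc n) \<le> real (Suc n) powr - s" for n
    using powr_telescope_bounds(2)[of "real (Suc n)" s] assms
    by (simp add: diff_divide_distrib add_ac)
  have le2: "real (Suc (Suc n)) powr - s \<le> ?f n - ?f (Suc n)" for n
    using powr_telescope_bounds(1)[of "real (Suc n)" s] assms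
    by (simp add: diff_divide_distrib add_ac)
  show "1 / (s - 1) \<le> zeta_real s"
    unfolding z1 using suminf_le[OF le1 sums_summable[OF tel] sm1] sums_unique[OF tel] by simp
  show "zeta_real s \<le> 1 + 1 / (s - 1)"
    unfolding z2 using suminf_le[OF le2 sm2 sums_summable[OF tel]] sums_unique[OF tel] by simp
qed

lemma zeta_real_ge_1: "s > 1 \<Longrightarrow> 1 \<le> zeta_real s"
  unfolding zeta_real_def using sum_le_suminf[OF summable_zeta, of s "{1}"] by simp

lemma summable_zeta_deriv:
  assumes "s > 1"
  shows "summable (\<lambda>n. ln (real n) * real n powr - s)"
proof (rule summable_comparison_test')
  \<comment> \<open>Half of the excess of s over 1 pays for the logarithm, through ln n <= n^a / a,
    and leaves an exponent above 1.\<close>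
  define a where "a = (s - 1) / 2"
  have a: "a > 0" "s - a > 1" using assms by (auto simp: a_def field_simps)
  show "summable (\<lambda>n. (1 / a) * real n powr - (s - a))"
    by (intro summable_mult summable_zeta a)
  show "norm (ln (real n) * real n powr - s) \<le> (1 / a) * real n powr - (s - a)" if "n \<ge> 1" for n
  proof -
    have "ln (real n) * real n powr - s \<le> real n powr a / a * real n powr - s"
      using that a by (intro mult_right_mono ln_powr_bound) auto
    also have "\<dots> = (1 / a) * real n powr - (s - a)"
      by (simp add: powr_add[symmetric])
    finally show ?thesis using that by simp
  qed
qed

lemma zeta_real_deriv:
  assumes "s > 1"
  shows "(zeta_real has_real_derivative - zeta_deriv s) (at s)"
proof -
  define a where "a = (1 + s) / 2"
  have a: "1 < a" "a < s" using assms by (auto simp: a_def)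
  have "((\<lambda>x. \<Sum>n. real n powr - x) has_real_derivative (\<Sum>n. - (ln (real n) * real n powr - s))) (at s)"
  \<comment> \<open>Termwise differentiation is justified on a half-line bounded away from 1, with
    the terms at a as summable majorant.\<close>
  proof (rule has_field_derivative_series'(2)[where S = "{a<..}" and ?x0.0 = s])
    show "((\<lambda>x. real n powr - x) has_real_derivative - (ln (real n) * real n powr - x))
        (at x within {a<..})" for n x
      by (cases "n = 0") (auto intro!: derivative_eq_intros simp: powr_def)
    show "uniformly_convergent_on {a<..} (\<lambda>n x. \<Sum>i<n. - (ln (real i) * real i powr - x))"
    proof (rule Weierstrass_m_test')
      show "norm (- (ln (real n) * real n powr - x)) \<le> ln (real n) * real n powr - a"
        if "x \<in> {a<..}" for n x
        using that by (cases "n = 0") (auto intro!: mult_left_mono powr_mono)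
    qed (rule summable_zeta_deriv[OF a(1)])
    show "s \<in> interior {a<..}" using a by (simp add: interior_open)
    show "summable (\<lambda>n. real n powr - s)" by (rule summable_zeta[OF assms])
  qed (use a in auto)
  then show ?thesis
    unfolding zeta_real_def zeta_deriv_def
    by (subst (asm) suminf_minus[OF summable_zeta_deriv[OF assms]])
qed

section \<open>The von Mangoldt function against zeta\<close>

abbreviation vonm :: "nat \<Rightarrow> real" where "vonm \<equiv> mangoldt"

text \<open>A finite, one-sided form of -\<zeta>'(s) = \<zeta>(s) \<Sum> \<Lambda>(q) q^(-s).
  Multiply out and collect the pairs (q, k) by their product n: the q in one class are distinct
  divisors of n, and the values of \<Lambda> at all divisors add up to ln n.\<close>

lemma mangoldt_dirichlet_le:
  assumes s: "s > 1" and Q: "finite Q"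
  shows "(\<Sum>q\<in>Q. vonm q * real q powr - s) * zeta_real s \<le> zeta_deriv s"
proof -
  define Q' where "Q' = Q - {0}"
  have Q': "finite Q'" "0 \<notin> Q'" using Q by (auto simp: Q'_def)
  have part: "(\<Sum>q\<in>Q. vonm q * real q powr - s) * (\<Sum>k<N. real k powr - s) \<le> zeta_deriv s" for N
  proof -
    let ?g = "\<lambda>(q, k). vonm q * real (q * k) powr - s"
    let ?S = "Q' \<times> {1..<N}"
    let ?f = "\<lambda>(q::nat, k::nat). q * k"
    have "(\<Sum>q\<in>Q. vonm q * real q powr - s) * (\<Sum>k<N. real k powr - s)
        = (\<Sum>q\<in>Q'. vonm q * real q powr - s) * (\<Sum>k=1..<N. real k powr - s)"
      by (intro arg_cong2[where f = "(*)"] sum.mono_neutral_right) (use Q in \<open>auto simp: Q'_def\<close>)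
    also have "\<dots> = (\<Sum>x\<in>?S. ?g x)"
      unfolding sum_product sum.cartesian_product by (simp add: powr_mult mult.assoc)
    also have "\<dots> = (\<Sum>n\<in>?f ` ?S. \<Sum>x\<in>{x\<in>?S. ?f x = n}. ?g x)"
      by (rule sum.image_gen) (use Q' in auto)
    also have "\<dots> \<le> (\<Sum>n\<in>?f ` ?S. ln (real n) * real n powr - s)"
    proof (rule sum_mono)
      fix n assume "n \<in> ?f ` ?S"
      then have n: "n > 0" using Q' by auto (metis gr0I)
      have "(\<Sum>x\<in>{x\<in>?S. ?f x = n}. ?g x) = (\<Sum>x\<in>{x\<in>?S. ?f x = n}. vonm (fst x) * real n powr - s)"
        by (rule sum.cong) auto
      \<comment> \<open>For a fixed product n and q > 0 the cofactor k is determined by q, so the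
        projection is injective on the class.\<close>
      also have "\<dots> = (\<Sum>q\<in>fst ` {x\<in>?S. ?f x = n}. vonm q * real n powr - s)"
        by (subst sum.reindex) (use Q' in \<open>auto simp: inj_on_def\<close>)
      also have "\<dots> \<le> (\<Sum>q | q dvd n. vonm q * real n powr - s)"
        by (rule sum_mono2) (use n in \<open>auto simp: mangoldt_nonneg\<close>)
      also have "\<dots> = ln (real n) * real n powr - s"
        using mangoldt_sum[of n, where 'a = real] n by (simp add: sum_distrib_right[symmetric])
      finally show "(\<Sum>x\<in>{x\<in>?S. ?f x = n}. ?g x) \<le> ln (real n) * real n powr - s" .
    qed
    also have "\<dots> \<le> zeta_deriv s"
      unfolding zeta_deriv_def
    proof (rule sum_le_suminf[OF summable_zeta_deriv[OF s]])
      show "0 \<le> ln (real n) * real n powr - s" for n by (cases "n = 0") auto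
    qed (use Q' in auto)
    finally show ?thesis .
  qed
  have "(\<lambda>N. (\<Sum>q\<in>Q. vonm q * real q powr - s) * (\<Sum>k<N. real k powr - s))
      \<longlonglongrightarrow> (\<Sum>q\<in>Q. vonm q * real q powr - s) * zeta_real s"
    unfolding zeta_real_def by (intro tendsto_intros summable_LIMSEQ summable_zeta s)
  then show ?thesis
    by (rule LIMSEQ_le_const2) (use part in auto)
qed

section \<open>The weights of the random walk\<close>

text \<open>
  Only a convention at s \<le> 1, where the series defining \<open>zeta_real\<close> diverges and its
  value is meaningless; the choice makes \<open>zeta_recip\<close> continuous at 1.
\<close>
definition zeta_recip :: "real \<Rightarrow> real" where
  "zeta_recip s = (if s > 1 then 1 / zeta_real s else 0)"

lemma zeta_recip_1 [simp]: "zeta_recip 1 = 0"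
  by (simp add: zeta_recip_def)

text \<open>With u = s - 1, inverting \<open>zeta_real_bounds\<close> gives u / (1 + u) <= 1 /
  \<zeta>(s) <= u. The quadratic lower bound follows from (u - u^2) (1 + u) = u - u^3 <= u.\<close>

lemma zeta_recip_bounds:
  assumes "s \<ge> 1"
  shows "0 \<le> zeta_recip s" "zeta_recip s \<le> 1" "zeta_recip s \<le> s - 1"
    "(s - 1) - (s - 1)\<^sup>2 \<le> zeta_recip s"
proof -
  have "0 \<le> zeta_recip s \<and> zeta_recip s \<le> 1 \<and> zeta_recip s \<le> s - 1 \<and> (s - 1) - (s - 1)\<^sup>2 \<le> zeta_recip s"
  proof (cases "s > 1")
    case True
    note z = zeta_real_ge_1[OF True] zeta_real_bounds[OF True]
    have "1 / zeta_real s \<le> 1 / (1 / (s - 1))"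
      using z True by (intro divide_left_mono mult_pos_pos) auto
    moreover have "1 / (1 + 1 / (s - 1)) \<le> 1 / zeta_real s"
      using z True by (intro divide_left_mono mult_pos_pos) (auto intro: add_pos_pos)
    moreover have "(s - 1) - (s - 1)\<^sup>2 \<le> 1 / (1 + 1 / (s - 1))"
    proof -
      have "(s - 1) - (s - 1)\<^sup>2 = ((s - 1) - (s - 1)\<^sup>2) * s / s" using True by simp
      also have "\<dots> \<le> (s - 1) / s"
      proof (rule divide_right_mono)
        have "((s - 1) - (s - 1)\<^sup>2) * s = (s - 1) - (s - 1) ^ 3"
          by (simp add: power2_eq_square power3_eq_cube algebra_simps)
        also have "\<dots> \<le> s - 1" using True by simp
        finally show "((s - 1) - (s - 1)\<^sup>2) * s \<le> s - 1" .
      qed (use True in simp)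
      also have "(s - 1) / s = 1 / (1 + 1 / (s - 1))" using True by (simp add: field_simps)
      finally show ?thesis .
    qed
    ultimately show ?thesis using z True by (simp add: zeta_recip_def)
  qed (use assms in \<open>auto simp: zeta_recip_def\<close>)
  then show "0 \<le> zeta_recip s" "zeta_recip s \<le> 1" "zeta_recip s \<le> s - 1"
    "(s - 1) - (s - 1)\<^sup>2 \<le> zeta_recip s" by auto
qed

lemma zeta_recip_deriv:
  assumes "s > 1"
  shows "(zeta_recip has_real_derivative zeta_deriv s / (zeta_real s)\<^sup>2) (at s)"
proof -
  have "((\<lambda>s. 1 / zeta_real s) has_real_derivative zeta_deriv s / (zeta_real s)\<^sup>2) (at s)"
    using zeta_real_ge_1[OF assms]
    by (auto intro!: derivative_eq_intros zeta_real_deriv assms simp: power2_eq_square)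
  then show ?thesis
    by (rule has_field_derivative_transform_within_open[where S = "{1<..}"])
      (use assms in \<open>auto simp: zeta_recip_def\<close>)
qed

lemma continuous_on_zeta_recip: "continuous_on {1..} zeta_recip"
  unfolding continuous_on_eq_continuous_within
proof
  fix s :: real assume "s \<in> {1..}"
  then consider "s = 1" | "s > 1" by fastforce
  then show "continuous (at s within {1..}) zeta_recip"
  proof cases
    case 1
    have "(zeta_recip \<longlongrightarrow> 0) (at 1 within {1..})"
    proof (rule tendsto_sandwich)
      show "\<forall>\<^sub>F s in at 1 within {1..}. 0 \<le> zeta_recip s" "\<forall>\<^sub>F s in at 1 within {1..}. zeta_recip s \<le> s - 1"
        by (auto simp: eventually_at_filter zeta_recip_bounds)
      show "((\<lambda>s. s - 1 :: real) \<longlongrightarrow> 0) (at 1 within {1..})"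
        by (auto intro!: tendsto_eq_intros)
    qed simp
    then show ?thesis using 1 by (simp add: continuous_within)
  next
    case 2
    then show ?thesis
      using DERIV_isCont[OF zeta_recip_deriv] continuous_at_imp_continuous_at_within by blast
  qed
qed

text \<open>Cutting at b keeps all integrals on compact intervals. At n = 1 the integrand tends to
  1, so there is no limit in b.\<close>

definition trunc_weight :: "real \<Rightarrow> nat \<Rightarrow> real" where
  "trunc_weight b n = integral {1..b} (\<lambda>s. real n powr - s * zeta_recip s)"

definition weight :: "nat \<Rightarrow> real" where
  "weight n = lim (\<lambda>j. trunc_weight (real j) n)"

text \<open>The function h of the overview. The point 1 is set apart because the walk starts there,
  whereas ln 1 = 0.\<close>

definition hit_mass :: "nat \<Rightarrow> real" where
  "hit_mass n = (if n = 1 then 1 else ln (real n) * weight n)"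

lemma trunc_weight_has_integral:
  assumes "n \<ge> 1"
  shows "((\<lambda>s. real n powr - s * zeta_recip s) has_integral trunc_weight b n) {1..b}"
  unfolding trunc_weight_def
  by (rule integrable_integral, rule integrable_continuous_interval)
    (use assms in \<open>auto intro!: continuous_intros continuous_on_subset[OF continuous_on_zeta_recip]\<close>)

text \<open>The antiderivative comes from integration by parts. Its value at s = 1 becomes the main
  term of \<open>weight\<close>.\<close>

lemma moment1_has_integral:
  fixes x b :: real
  assumes "x > 1" "b \<ge> 1"
  shows "((\<lambda>s. (s - 1) * x powr - s) has_integral
    (1 / (x * (ln x)\<^sup>2) - x powr - b * ((b - 1) / ln x + 1 / (ln x)\<^sup>2))) {1..b}"
proof -
  let ?F = "\<lambda>s. - (x powr - s * ((s - 1) / ln x + 1 / (ln x)\<^sup>2))"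
  have "((\<lambda>s. (s - 1) * x powr - s) has_integral (?F b - ?F 1)) {1..b}"
  proof (rule fundamental_theorem_of_calculus[OF assms(2)])
    fix s
    have "(?F has_real_derivative (s - 1) * x powr - s) (at s within {1..b})"
      using assms
      by (auto intro!: derivative_eq_intros simp: powr_def field_simps power2_eq_square)
    then show "(?F has_vector_derivative (s - 1) * x powr - s) (at s within {1..b})"
      by (simp add: has_real_derivative_iff_has_vector_derivative)
  qed
  then show ?thesis using assms by (simp add: powr_minus field_simps)
qed

text \<open>The value at s = 1 becomes the error term of \<open>weight\<close>.\<close>

lemma moment2_has_integral:
  fixes x b :: real
  assumes "x > 1" "b \<ge> 1"
  shows "((\<lambda>s. (s - 1)\<^sup>2 * x powr - s) has_integral
    (2 / (x * (ln x) ^ 3) - x powr - b * ((b - 1)\<^sup>2 / ln x + 2 * (b - 1) / (ln x)\<^sup>2 + 2 / (ln x) ^ 3))) {1..b}"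
proof -
  let ?F = "\<lambda>s. - (x powr - s * ((s - 1)\<^sup>2 / ln x + 2 * (s - 1) / (ln x)\<^sup>2 + 2 / (ln x) ^ 3))"
  have "((\<lambda>s. (s - 1)\<^sup>2 * x powr - s) has_integral (?F b - ?F 1)) {1..b}"
  proof (rule fundamental_theorem_of_calculus[OF assms(2)])
    fix s
    have "(?F has_real_derivative (s - 1)\<^sup>2 * x powr - s) (at s within {1..b})"
      using assms
      by (auto intro!: derivative_eq_intros simp: powr_def field_simps power2_eq_square power3_eq_cube)
    then show "(?F has_vector_derivative (s - 1)\<^sup>2 * x powr - s) (at s within {1..b})"
      by (simp add: has_real_derivative_iff_has_vector_derivative)
  qed
  then show ?thesis using assms by (simp add: powr_minus field_simps)
qed

text \<open>Integrate u - u^2 <= 1 / \<zeta>(s) <= u, where u = s - 1, against n^(-s). In the lower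
  bound the term at b from the first moment is kept, as it vanishes for large b; the one from the
  second moment has a favourable sign and is dropped.\<close>

lemma trunc_weight_bounds:
  assumes "n \<ge> 2" "b \<ge> 1"
  shows "trunc_weight b n \<le> 1 / (real n * (ln (real n))\<^sup>2)"
    and "1 / (real n * (ln (real n))\<^sup>2) - 2 / (real n * (ln (real n)) ^ 3)
      - real n powr - b * ((b - 1) / ln (real n) + 1 / (ln (real n))\<^sup>2) \<le> trunc_weight b n"
proof -
  have n: "real n > 1" "n \<ge> 1" "ln (real n) > 0" using assms by auto
  note I = trunc_weight_has_integral[OF n(2), of b]
  note m1 = moment1_has_integral[OF n(1) assms(2)]
  note m2 = moment2_has_integral[OF n(1) assms(2)]
  have "trunc_weight b n \<le> 1 / (real n * (ln (real n))\<^sup>2)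
      - real n powr - b * ((b - 1) / ln (real n) + 1 / (ln (real n))\<^sup>2)"
  proof (rule has_integral_le[OF I m1])
    fix s assume "s \<in> {1..b}"
    then show "real n powr - s * zeta_recip s \<le> (s - 1) * real n powr - s"
      using zeta_recip_bounds(3)[of s] by (simp add: mult_right_mono mult.commute)
  qed
  also have "\<dots> \<le> 1 / (real n * (ln (real n))\<^sup>2)"
    using mult_nonneg_nonneg[of "real n powr - b" "(b - 1) / ln (real n) + 1 / (ln (real n))\<^sup>2"] n assms
    by simp
  finally show "trunc_weight b n \<le> 1 / (real n * (ln (real n))\<^sup>2)" .
  have "1 / (real n * (ln (real n))\<^sup>2) - real n powr - b * ((b - 1) / ln (real n) + 1 / (ln (real n))\<^sup>2)
     - (2 / (real n * (ln (real n)) ^ 3) - real n powr - b * ((b - 1)\<^sup>2 / ln (real n) + 2 * (b - 1) / (ln (real n))\<^sup>2 + 2 / (ln (real n)) ^ 3))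
     \<le> trunc_weight b n"
  proof (rule has_integral_le[OF has_integral_diff[OF m1 m2] I])
    fix s assume "s \<in> {1..b}"
    then have "((s - 1) - (s - 1)\<^sup>2) * real n powr - s \<le> zeta_recip s * real n powr - s"
      using zeta_recip_bounds(4)[of s] by (intro mult_right_mono) auto
    then show "(s - 1) * real n powr - s - (s - 1)\<^sup>2 * real n powr - s \<le> real n powr - s * zeta_recip s"
      by (simp add: algebra_simps)
  qed
  moreover have "0 \<le> real n powr - b * ((b - 1)\<^sup>2 / ln (real n) + 2 * (b - 1) / (ln (real n))\<^sup>2 + 2 / (ln (real n)) ^ 3)"
    using n assms by (intro mult_nonneg_nonneg add_nonneg_nonneg divide_nonneg_nonneg) auto
  ultimately show "1 / (real n * (ln (real n))\<^sup>2) - 2 / (real n * (ln (real n)) ^ 3)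
      - real n powr - b * ((b - 1) / ln (real n) + 1 / (ln (real n))\<^sup>2) \<le> trunc_weight b n"
    by linarith
qed

text \<open>The truncated integrals increase, the integrand being nonnegative, and are bounded by
  \<open>trunc_weight_bounds\<close>.\<close>

lemma trunc_weight_LIMSEQ:
  assumes "n \<ge> 2"
  shows "(\<lambda>j. trunc_weight (real j) n) \<longlonglongrightarrow> weight n"
proof -
  let ?f = "\<lambda>s. real n powr - s * zeta_recip s"
  have inc: "incseq (\<lambda>j. trunc_weight (real j) n)"
  proof (rule incseq_SucI)
    fix j
    have "integral {1..real j} ?f \<le> integral {1..real (Suc j)} ?f"
      using trunc_weight_has_integral[of n] assms
      by (intro integral_subset_le) (auto intro!: mult_nonneg_nonneg zeta_recip_bounds)
    then show "trunc_weight (real j) n \<le> trunc_weight (real (Suc j)) n"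
      by (simp add: trunc_weight_def)
  qed
  have bd: "trunc_weight (real j) n \<le> 1 / (real n * (ln (real n))\<^sup>2)" for j
  proof (cases "j = 0")
    case True
    then show ?thesis by (simp add: trunc_weight_def)
  qed (use trunc_weight_bounds(1)[OF assms, of "real j"] in auto)
  obtain L where "(\<lambda>j. trunc_weight (real j) n) \<longlonglongrightarrow> L"
    using incseq_convergent[OF inc, of "1 / (real n * (ln (real n))\<^sup>2)"] bd by metis
  then show ?thesis
    unfolding weight_def by (simp add: limI)
qed

lemma weight_bounds:
  assumes "n \<ge> 2"
  shows "0 \<le> weight n"
    and "weight n \<le> 1 / (real n * (ln (real n))\<^sup>2)"
    and "1 / (real n * (ln (real n))\<^sup>2) - 2 / (real n * (ln (real n)) ^ 3) \<le> weight n"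
proof -
  note lim = trunc_weight_LIMSEQ[OF assms]
  have n: "real n > 1" using assms by auto
  have nonneg: "0 \<le> trunc_weight (real j) n" for j
    unfolding trunc_weight_def using trunc_weight_has_integral[of n] assms
    by (intro integral_nonneg) (auto intro!: mult_nonneg_nonneg zeta_recip_bounds)
  show "0 \<le> weight n"
    by (rule LIMSEQ_le_const[OF lim]) (use nonneg in auto)
  show "weight n \<le> 1 / (real n * (ln (real n))\<^sup>2)"
    by (rule LIMSEQ_le_const2[OF lim]) (use trunc_weight_bounds(1)[OF assms] in \<open>auto intro!: exI[of _ 1]\<close>)
  have "(\<lambda>j. 1 / (real n * (ln (real n))\<^sup>2) - 2 / (real n * (ln (real n)) ^ 3)
      - real n powr - real j * ((real j - 1) / ln (real n) + 1 / (ln (real n))\<^sup>2))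
    \<longlonglongrightarrow> 1 / (real n * (ln (real n))\<^sup>2) - 2 / (real n * (ln (real n)) ^ 3) - 0"
  proof (intro tendsto_diff tendsto_const)
    have "ln (real n) > 0" using n by simp
    then show "(\<lambda>j. real n powr - real j * ((real j - 1) / ln (real n) + 1 / (ln (real n))\<^sup>2)) \<longlonglongrightarrow> 0"
      using n by real_asymp
  qed
  then have "1 / (real n * (ln (real n))\<^sup>2) - 2 / (real n * (ln (real n)) ^ 3) - 0 \<le> weight n"
  proof (rule LIMSEQ_le[OF _ lim])
    show "\<exists>N. \<forall>j\<ge>N. 1 / (real n * (ln (real n))\<^sup>2) - 2 / (real n * (ln (real n)) ^ 3)
      - real n powr - real j * ((real j - 1) / ln (real n) + 1 / (ln (real n))\<^sup>2) \<le> trunc_weight (real j) n"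
      using trunc_weight_bounds(2)[OF assms] by (intro exI[of _ 1] allI impI) simp
  qed
  then show "1 / (real n * (ln (real n))\<^sup>2) - 2 / (real n * (ln (real n)) ^ 3) \<le> weight n"
    by simp
qed

text \<open>
  With F(s) = m^(-s) / \<zeta>(s), the derivative of F is m^(-s) (-\<zeta>'(s)) / \<zeta>(s)^2 - ln m * F(s), and
  -\<zeta>'(s) dominates \<zeta>(s) times any finite part of the Dirichlet series of \<open>mangoldt\<close>; now
  integrate over [1, b], where F(1) = 0.
\<close>
lemma trunc_weight_transition:
  assumes m: "m \<ge> 1" and b: "b \<ge> 1" and Q: "finite Q"
  shows "(\<Sum>q\<in>Q. vonm q * trunc_weight b (m * q))
    \<le> ln (real m) * trunc_weight b m + real m powr - b * zeta_recip b"
proof -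
  define Q' where "Q' = Q - {0}"
  let ?F = "\<lambda>s. real m powr - s * zeta_recip s"
  \<comment> \<open>At s = 1 the derivative formula is meaningless. The interior form of the
    fundamental theorem asks for it only on the open interval, and the value 0 makes
    \<open>?g s \<le> F' s\<close> an equality at 1.\<close>
  define F' where "F' = (\<lambda>s. if s > 1 then real m powr - s * (zeta_deriv s / (zeta_real s)\<^sup>2)
      - ln (real m) * (real m powr - s * zeta_recip s) else 0)"
  let ?g = "\<lambda>s. (\<Sum>q\<in>Q'. vonm q * (real (m * q) powr - s * zeta_recip s))
      - ln (real m) * (real m powr - s * zeta_recip s)"
  have I1: "(F' has_integral (?F b - ?F 1)) {1..b}"
  proof (rule fundamental_theorem_of_calculus_interior[OF b])
    show "continuous_on {1..b} ?F"
      using m by (auto intro!: continuous_intros continuous_on_subset[OF continuous_on_zeta_recip])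
    show "(?F has_vector_derivative F' s) (at s)" if "s \<in> {1<..<b}" for s
    proof -
      have "(?F has_real_derivative F' s) (at s)"
        using that m
        by (auto intro!: derivative_eq_intros zeta_recip_deriv simp: F'_def powr_def algebra_simps)
      then show ?thesis by (simp add: has_real_derivative_iff_has_vector_derivative)
    qed
  qed
  have I2: "(?g has_integral ((\<Sum>q\<in>Q'. vonm q * trunc_weight b (m * q)) - ln (real m) * trunc_weight b m)) {1..b}"
    using m Q by (intro has_integral_diff has_integral_sum has_integral_mult_right trunc_weight_has_integral)
      (auto simp: Q'_def)
  have le: "?g s \<le> F' s" if "s \<in> {1..b}" for s
  proof (cases "s > 1")
    case True
    note z = zeta_real_ge_1[OF True]
    have "(\<Sum>q\<in>Q'. vonm q * (real (m * q) powr - s * zeta_recip s))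
        = real m powr - s * ((\<Sum>q\<in>Q'. vonm q * real q powr - s) * zeta_real s / (zeta_real s)\<^sup>2)"
      using True z
      by (simp add: zeta_recip_def powr_mult sum_distrib_left sum_distrib_right sum_divide_distrib power2_eq_square mult_ac)
    also have "\<dots> \<le> real m powr - s * (zeta_deriv s / (zeta_real s)\<^sup>2)"
      using mangoldt_dirichlet_le[OF True, of Q'] Q
      by (intro mult_left_mono divide_right_mono) (auto simp: Q'_def)
    finally show ?thesis using True by (simp add: F'_def)
  qed (use that in \<open>auto simp: F'_def zeta_recip_def\<close>)
  have "(\<Sum>q\<in>Q'. vonm q * trunc_weight b (m * q)) - ln (real m) * trunc_weight b m \<le> ?F b - ?F 1"
    by (rule has_integral_le[OF I2 I1 le])
  moreover have "(\<Sum>q\<in>Q. vonm q * trunc_weight b (m * q)) = (\<Sum>q\<in>Q'. vonm q * trunc_weight b (m * q))"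
    using Q by (intro sum.mono_neutral_right) (auto simp: Q'_def)
  ultimately show ?thesis by simp
qed

text \<open>Let b tend to infinity in \<open>trunc_weight_transition\<close>. The boundary term
  vanishes for m >= 2; for m = 1 it is only at most 1, which is exactly \<open>hit_mass 1\<close>.
  This inequality lets the jump probabilities at m add up to at most 1.\<close>

lemma weight_transition:
  assumes m: "m \<ge> 1" and Q: "finite Q"
  shows "(\<Sum>q\<in>Q. vonm q * weight (m * q)) \<le> hit_mass m"
proof -
  have lim: "(\<lambda>j. \<Sum>q\<in>Q. vonm q * trunc_weight (real j) (m * q)) \<longlonglongrightarrow> (\<Sum>q\<in>Q. vonm q * weight (m * q))"
  proof (rule tendsto_sum)
    fix q assume "q \<in> Q"
    show "(\<lambda>j. vonm q * trunc_weight (real j) (m * q)) \<longlonglongrightarrow> vonm q * weight (m * q)"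
    \<comment> \<open>\<Lambda> vanishes at 0 and 1, which disposes of the case m * q = 1, where
      \<open>trunc_weight\<close> has no limit.\<close>
    proof (cases "q \<le> 1")
      case True
      then have "q = 0 \<or> q = 1" by auto
      then show ?thesis by auto
    next
      case False
      then have "2 \<le> m * q" using m by (metis mult_le_mono mult_1 not_less_eq_eq numeral_2_eq_2 One_nat_def)
      then show ?thesis by (intro tendsto_intros trunc_weight_LIMSEQ)
    qed
  qed
  show ?thesis
  proof (cases "m = 1")
    case True
    show ?thesis
    proof (rule LIMSEQ_le_const2[OF lim], intro exI[of _ 1] allI impI)
      fix j :: nat assume "1 \<le> j"
      then show "(\<Sum>q\<in>Q. vonm q * trunc_weight (real j) (m * q)) \<le> hit_mass m"
        using trunc_weight_transition[OF m _ Q, of "real j"] zeta_recip_bounds(2)[of "real j"] True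
        by (auto simp: hit_mass_def)
    qed
  next
    case False
    with m have m2: "m \<ge> 2" by simp
    have "(\<lambda>j. ln (real m) * trunc_weight (real j) m + real m powr - real j * 1) \<longlonglongrightarrow> ln (real m) * weight m + 0"
    proof (intro tendsto_add tendsto_mult tendsto_const trunc_weight_LIMSEQ m2)
      have "real m > 1" using m2 by simp
      then show "(\<lambda>j. real m powr - real j * 1) \<longlonglongrightarrow> 0" by real_asymp
    qed
    moreover have "(\<Sum>q\<in>Q. vonm q * trunc_weight (real j) (m * q))
        \<le> ln (real m) * trunc_weight (real j) m + real m powr - real j * 1" if "j \<ge> 1" for j
      using trunc_weight_transition[OF m _ Q, of "real j"] zeta_recip_bounds(2)[of "real j"] that
        mult_left_mono[of "zeta_recip (real j)" 1 "real m powr - real j"] by auto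
    ultimately have "(\<Sum>q\<in>Q. vonm q * weight (m * q)) \<le> ln (real m) * weight m + 0"
      using LIMSEQ_le[OF lim] by blast
    then show ?thesis using False by (simp add: hit_mass_def)
  qed
qed

text \<open>Multiply \<open>weight_bounds\<close> by ln n. The gap between the two bounds is
  summable.\<close>

lemma hit_mass_bounds:
  assumes "n \<ge> 2"
  shows "hit_mass n \<le> 1 / (real n * ln (real n))"
    and "1 / (real n * ln (real n)) - 2 / (real n * (ln (real n))\<^sup>2) \<le> hit_mass n"
proof -
  have L: "ln (real n) > 0" using assms by simp
  have "ln (real n) * weight n \<le> ln (real n) * (1 / (real n * (ln (real n))\<^sup>2))"
    using L by (intro mult_left_mono weight_bounds assms) auto
  then show "hit_mass n \<le> 1 / (real n * ln (real n))"
    using L assms by (simp add: hit_mass_def power2_eq_square)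
  have "ln (real n) * (1 / (real n * (ln (real n))\<^sup>2) - 2 / (real n * (ln (real n)) ^ 3)) \<le> ln (real n) * weight n"
    using L by (intro mult_left_mono weight_bounds assms) auto
  then show "1 / (real n * ln (real n)) - 2 / (real n * (ln (real n))\<^sup>2) \<le> hit_mass n"
    using L assms by (simp add: hit_mass_def power2_eq_square power3_eq_cube right_diff_distrib)
qed

lemma hit_mass_nonneg: "n \<ge> 1 \<Longrightarrow> 0 \<le> hit_mass n"
  using weight_bounds(1)[of n] by (cases "n = 1") (simp_all add: hit_mass_def)

section \<open>The random walk\<close>

lemma exists_pmf_extending:
  fixes f :: "nat \<Rightarrow> real"
  assumes nonneg: "\<And>q. 0 \<le> f q" and le: "\<And>N. sum f {..<N} \<le> 1" and f0: "f 0 = 0"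
  shows "\<exists>p. \<forall>q\<ge>1. pmf p q = f q"
proof -
  have sm: "summable f" by (rule summableI_nonneg_bounded[OF nonneg le])
  have le1: "suminf f \<le> 1" by (rule suminf_le_const[OF sm le])
  define g where "g = (\<lambda>q. f q + (if q = 0 then 1 - suminf f else 0))"
  have g0: "0 \<le> g q" for q using nonneg[of q] le1 by (simp add: g_def)
  have "g sums (suminf f + (1 - suminf f))"
    unfolding g_def by (intro sums_add summable_sums[OF sm] sums_single)
  then have g: "g sums 1" by simp
  have "(\<integral>\<^sup>+ x. ennreal (g x) \<partial>count_space UNIV) = (\<Sum>x. ennreal (g x))"
    by (rule nn_integral_count_space_nat)
  also have "\<dots> = 1"
    using suminf_ennreal2[OF g0 sums_summable[OF g]] sums_unique[OF g] by simp
  finally have "pmf (embed_pmf g) q = g q" for q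
    using g0 by (intro pmf_embed_pmf) auto
  then show ?thesis by (intro exI[of _ "embed_pmf g"]) (simp add: g_def)
qed

text \<open>
  The law of the factor q by which the walk at m is multiplied. The value 0 carries the missing mass
  and means that the walk dies at m.
\<close>
definition step_pmf :: "nat \<Rightarrow> nat pmf" where
  "step_pmf m = (SOME p. \<forall>q\<ge>1. pmf p q = vonm q * weight (m * q) / hit_mass m)"

lemma mangoldt_weight_nonneg: "m \<ge> 1 \<Longrightarrow> 0 \<le> vonm q * weight (m * q)"
proof (cases "q \<le> 1")
  case True
  then have "q = 0 \<or> q = Suc 0" by auto
  then show ?thesis by auto
next
  case False
  assume "m \<ge> 1"
  then have "1 * 2 \<le> m * q" using False by (intro mult_le_mono) auto
  then show ?thesis by (intro mult_nonneg_nonneg weight_bounds mangoldt_nonneg) auto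
qed

text \<open>The multiplied form also covers \<open>hit_mass m = 0\<close>: then
  \<open>weight_transition\<close> for the single factor q forces the right-hand side to
  vanish.\<close>

lemma pmf_step_pmf:
  assumes "m \<ge> 1" "q \<ge> 1"
  shows "hit_mass m * pmf (step_pmf m) q = vonm q * weight (m * q)"
proof -
  have h: "0 \<le> hit_mass m" using assms by (intro hit_mass_nonneg)
  have "\<exists>p. \<forall>q\<ge>1. pmf p q = vonm q * weight (m * q) / hit_mass m"
  proof (rule exists_pmf_extending)
    show "0 \<le> vonm q * weight (m * q) / hit_mass m" for q
      using assms h by (intro divide_nonneg_nonneg mangoldt_weight_nonneg)
    show "(\<Sum>q<N. vonm q * weight (m * q) / hit_mass m) \<le> 1" for N
      using weight_transition[OF assms(1), of "{..<N}"] h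
      by (cases "hit_mass m = 0") (auto simp: sum_divide_distrib[symmetric])
  qed simp
  from someI_ex[OF this] have "pmf (step_pmf m) q = vonm q * weight (m * q) / hit_mass m"
    unfolding step_pmf_def using assms by blast
  moreover have "vonm q * weight (m * q) = 0" if "hit_mass m = 0"
    using weight_transition[OF assms(1), of "{q}"] mangoldt_weight_nonneg[OF assms(1), of q] that by simp
  ultimately show ?thesis by (cases "hit_mass m = 0") auto
qed

text \<open>
  The factors at all positions are drawn in advance and independently: \<open>w m\<close> is the one
  used if the walk reaches m, which can happen at most once.
\<close>
inductive hit :: "(nat \<Rightarrow> nat) \<Rightarrow> nat \<Rightarrow> bool" for w where
  start: "hit w 1"
| step: "hit w m \<Longrightarrow> w m \<ge> 2 \<Longrightarrow> hit w (m * w m)"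

lemma hit_Suc_0 [simp]: "hit w (Suc 0)"
  using hit.start by simp

lemma hit_pos: "hit w n \<Longrightarrow> n \<ge> 1"
  by (induction rule: hit.induct) auto

text \<open>Undoing the last jump strictly decreases the position, so statements about
  \<open>hit\<close> can be proved by strong induction.\<close>

lemma hit_iff:
  "hit w n \<longleftrightarrow> n = 1 \<or> (\<exists>m<n. hit w m \<and> w m \<ge> 2 \<and> n = m * w m)"
proof
  assume "hit w n"
  then show "n = 1 \<or> (\<exists>m<n. hit w m \<and> w m \<ge> 2 \<and> n = m * w m)"
  proof cases
    case (step m)
    then have "m < n" using hit_pos[of w m] by simp
    with step show ?thesis by blast
  qed simp
qed (auto intro: hit.intros)

text \<open>Induct on b through its predecessor m. If a < m, use the hypothesis for the target m; if
  m < a, the hypothesis for the target a gives b dvd a, against a < b.\<close>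

lemma hit_successor_dvd:
  assumes "hit w a" "hit w b" "a < b"
  shows "a * w a dvd b"
  using assms
proof (induction b arbitrary: a rule: less_induct)
  case (less b)
  have "b \<noteq> 1" using less.prems hit_pos[of w a] by auto
  then obtain m where m: "m < b" "hit w m" "w m \<ge> 2" "b = m * w m"
    using less.prems(2) hit_iff[of w b] by blast
  consider "a < m" | "a = m" | "m < a" by linarith
  then show ?case
  proof cases
    case 1
    then show ?thesis using less.IH[OF m(1) less.prems(1) m(2)] m(4) by simp
  next
    case 3
    then have "b dvd a" using less.IH[OF less.prems(3) m(2) less.prems(1)] m(4) by simp
    then show ?thesis using less.prems hit_pos[of w a] by (auto dest: dvd_imp_le)
  qed (use m in simp)
qed

lemma hit_dvd: "hit w a \<Longrightarrow> hit w b \<Longrightarrow> a \<le> b \<Longrightarrow> a dvd b"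
  using hit_successor_dvd[of w a b] dvd_mult_left[of a "w a" b] by (cases "a = b") simp_all

text \<open>Positions strictly increase, so reaching n involves only the factors drawn below n. This
  is the source of its independence from \<open>w n\<close>.\<close>

lemma hit_cong:
  assumes "\<And>k. k < n \<Longrightarrow> w k = v k"
  shows "hit w n \<longleftrightarrow> hit v n"
  using assms
proof (induction n rule: less_induct)
  case (less n)
  have "hit w m = hit v m" "w m = v m" if "m < n" for m
    using less.IH[OF that] less.prems that by simp_all
  then have "(\<exists>m<n. hit w m \<and> w m \<ge> 2 \<and> n = m * w m) \<longleftrightarrow> (\<exists>m<n. hit v m \<and> v m \<ge> 2 \<and> n = m * v m)"
    by metis
  then show ?case by (simp only: hit_iff[of w n] hit_iff[of v n])
qed

section \<open>Measurability and visit probabilities\<close>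

definition step_space :: "nat set \<Rightarrow> (nat \<Rightarrow> nat) measure" where
  "step_space I = PiM I (\<lambda>m. measure_pmf (step_pmf m))"

lemma prob_space_step_space: "prob_space (step_space I)"
  unfolding step_space_def by (intro prob_space_PiM measure_pmf.prob_space_axioms)

lemma space_step_space_UNIV [simp]: "space (step_space UNIV) = UNIV"
  by (simp add: step_space_def space_PiM)

lemma sets_coordinate:
  assumes "m \<in> I"
  shows "{w \<in> space (step_space I). P (w m)} \<in> sets (step_space I)"
proof -
  have "(\<lambda>w. w m) \<in> measurable (step_space I) (measure_pmf (step_pmf m))"
    unfolding step_space_def by (rule measurable_component_singleton[OF assms])
  from measurable_sets[OF this, of "Collect P"] show ?thesis
    by (simp add: vimage_def Int_def conj_commute)
qed

text \<open>By \<open>hit_iff\<close> the event is a finite union over predecessors. The general I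
  serves both the whole space and its restriction to \<open>{..<n}\<close>.\<close>

lemma sets_hit:
  "{..<n} \<subseteq> I \<Longrightarrow> {w \<in> space (step_space I). hit w n} \<in> sets (step_space I)"
proof (induction n rule: less_induct)
  case (less n)
  have IH: "{w \<in> space (step_space I). hit w m} \<in> sets (step_space I)" if "m < n" for m
    by (rule less.IH[OF that]) (use less.prems that in auto)
  have "{w \<in> space (step_space I). hit w n} = (if n = 1 then space (step_space I) else {}) \<union>
     (\<Union>m<n. {w \<in> space (step_space I). hit w m} \<inter> {w \<in> space (step_space I). w m \<ge> 2 \<and> n = m * w m})"
    by (subst hit_iff) auto
  also have "\<dots> \<in> sets (step_space I)"
    using less.prems by (intro sets.Un sets.finite_UN sets.Int sets_coordinate IH) auto
  finally show ?case .
qed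

text \<open>The visit to m is determined by the coordinates below m, the jump by the coordinate m,
  and these two blocks are independent.\<close>

lemma prob_hit_step:
  "measure (step_space UNIV) {w. hit w m \<and> w m = q}
    = measure (step_space UNIV) {w. hit w m} * pmf (step_pmf m) q"
proof -
  interpret prob_space "step_space UNIV" by (rule prob_space_step_space)
  interpret pp: product_prob_space "\<lambda>m. measure_pmf (step_pmf m)" UNIV ..
  have "indep_vars (\<lambda>m. measure_pmf (step_pmf m)) (\<lambda>m w. w m) UNIV"
  proof (subst indep_vars_iff_distr_eq_PiM)
    show "random_variable (measure_pmf (step_pmf i)) (\<lambda>w. w i)" for i
      unfolding step_space_def by (rule measurable_component_singleton) simp
    show "distr (step_space UNIV) (Pi\<^sub>M UNIV (\<lambda>m. measure_pmf (step_pmf m))) (\<lambda>x. \<lambda>i\<in>UNIV. x i)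
       = Pi\<^sub>M UNIV (\<lambda>i. distr (step_space UNIV) (measure_pmf (step_pmf i)) (\<lambda>w. w i))"
      unfolding step_space_def by (simp add: pp.PiM_component distr_id2 restrict_def)
  qed simp
  then have ind: "indep_var (PiM {..<m} (\<lambda>m. measure_pmf (step_pmf m))) (\<lambda>w. restrict w {..<m})
      (PiM {m} (\<lambda>m. measure_pmf (step_pmf m))) (\<lambda>w. restrict w {m})"
    by (rule indep_var_restrict) auto
  \<comment> \<open>Pulled back along the two restrictions, \<open>?A\<close> and \<open>?B\<close>
    become the events in question.\<close>
  let ?A = "{v \<in> space (step_space {..<m}). hit v m}"
  let ?B = "{v \<in> space (step_space {m}). v m = q}"
  have hit_restrict: "hit (restrict w {..<m}) m \<longleftrightarrow> hit w m" for w
    by (rule hit_cong) simp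
  have A: "(\<lambda>w. restrict w {..<m}) -` ?A \<inter> space (step_space UNIV) = {w. hit w m}"
    using hit_restrict by (auto simp: step_space_def space_PiM)
  have B: "(\<lambda>w. restrict w {m}) -` ?B \<inter> space (step_space UNIV) = {w. w m = q}"
    by (auto simp: step_space_def space_PiM)
  have AB: "(\<lambda>w. (restrict w {..<m}, restrict w {m})) -` (?A \<times> ?B) \<inter> space (step_space UNIV)
      = {w. hit w m} \<inter> {w. w m = q}"
    unfolding A[symmetric] unfolding B[symmetric] by blast
  have "prob ({w. hit w m} \<inter> {w. w m = q}) = prob {w. hit w m} * prob {w. w m = q}"
    using indep_varD[OF ind, of ?A ?B] sets_hit[of m "{..<m}"] sets_coordinate[of m "{m}" "\<lambda>x. x = q"]
    unfolding A B AB by (simp add: step_space_def)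
  moreover have "prob {w. w m = q} = pmf (step_pmf m) q"
  proof -
    have "prob {w. w m = q} = measure (distr (step_space UNIV) (measure_pmf (step_pmf m)) (\<lambda>w. w m)) {q}"
      by (subst measure_distr) (auto simp: step_space_def vimage_def space_PiM intro: measurable_component_singleton)
    also have "\<dots> = measure (measure_pmf (step_pmf m)) {q}"
      unfolding step_space_def by (subst pp.PiM_component) auto
    finally show ?thesis by (simp add: measure_pmf_single)
  qed
  ultimately show ?thesis by (simp add: Collect_conj_eq)
qed

text \<open>Split by the last position m before n, a proper divisor of n. By induction and
  \<open>pmf_step_pmf\<close> this case has probability \<Lambda>(n / m) I(n), the factor h(m)
  cancelling, and the values of \<Lambda> at the divisors of n add up to ln n.\<close>

lemma prob_hit:
  "n \<ge> 1 \<Longrightarrow> measure (step_space UNIV) {w. hit w n} = hit_mass n"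
proof (induction n rule: less_induct)
  case (less n)
  interpret prob_space "step_space UNIV" by (rule prob_space_step_space)
  show ?case
  proof (cases "n = 1")
    case True
    then have "{w. hit w n} = space (step_space UNIV)" by (auto intro: hit.start)
    then show ?thesis using True prob_space by (simp add: hit_mass_def)
  next
    case False
    let ?D = "{m. m dvd n \<and> m < n}"
    have D: "m \<ge> 1 \<and> n div m \<ge> 2 \<and> m * (n div m) = n" if "m \<in> ?D" for m
    proof -
      from that obtain k where k: "n = m * k" by auto
      have "k \<noteq> 0" "k \<noteq> 1" "m \<noteq> 0" using that less.prems unfolding k by auto
      then show ?thesis unfolding k by simp
    qed
    have E1: "\<exists>m\<in>?D. hit w m \<and> w m = n div m" if hitn: "hit w n" for w
    proof -
      obtain m where m: "m < n" "hit w m" "n = m * w m"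
        using False hit_iff[of w n] hitn by blast
      then have "m \<in> ?D" "w m = n div m" using hit_pos[OF m(2)] unfolding m(3) by auto
      then show ?thesis using m(2) by blast
    qed
    have E2: "hit w n" if "m \<in> ?D" "hit w m" "w m = n div m" for w m
      using D[OF that(1)] hit.step[OF that(2)] that(3) by simp
    have E: "{w. hit w n} = (\<Union>m\<in>?D. {w. hit w m \<and> w m = n div m})"
      using E1 E2 by blast
    have disj: "disjoint_family_on (\<lambda>m. {w. hit w m \<and> w m = n div m}) ?D"
      unfolding disjoint_family_on_def
    proof (intro ballI impI)
      \<comment> \<open>Two predecessors a < b of n cannot both occur: n, the successor of a, would
        divide b < n.\<close>
      have *: "{w. hit w a \<and> w a = n div a} \<inter> {w. hit w b \<and> w b = n div b} = {}"
        if "a \<in> ?D" "b \<in> ?D" "a < b" for a b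
      proof -
        have False if "hit w a" "hit w b" "w a = n div a" for w
        proof -
          have "n dvd b"
            using hit_successor_dvd[OF that(1,2) \<open>a < b\<close>] that(3) D[OF \<open>a \<in> ?D\<close>] by simp
          then show False using \<open>b \<in> ?D\<close> D[OF \<open>b \<in> ?D\<close>] by (auto dest: dvd_imp_le)
        qed
        then show ?thesis by blast
      qed
      show "{w. hit w a \<and> w a = n div a} \<inter> {w. hit w b \<and> w b = n div b} = {}"
        if "a \<in> ?D" "b \<in> ?D" "a \<noteq> b" for a b
      proof (cases "a < b")
        case True
        then show ?thesis by (rule *[OF that(1,2)])
      next
        case False
        then have "b < a" using that by simp
        then show ?thesis using *[OF that(2,1)] by (simp add: Int_commute)
      qed
    qed
    have meas: "{w. hit w m \<and> w m = k} \<in> events" for m k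
      using sets.Int[OF sets_hit[of m UNIV] sets_coordinate[of m UNIV "\<lambda>x. x = k"]]
      by (simp add: Collect_conj_eq)
    have "measure (step_space UNIV) {w. hit w n} = (\<Sum>m\<in>?D. prob {w. hit w m \<and> w m = n div m})"
      unfolding E by (rule finite_measure_finite_Union) (use disj meas in auto)
    also have "\<dots> = (\<Sum>m\<in>?D. vonm (n div m) * weight n)"
    proof (rule sum.cong)
      fix m assume m: "m \<in> ?D"
      then show "prob {w. hit w m \<and> w m = n div m} = vonm (n div m) * weight n"
        using less.IH[of m] D[OF m] pmf_step_pmf[of m "n div m"] by (simp add: prob_hit_step)
    qed simp
    \<comment> \<open>The divisor m = n may be added because \<Lambda>(1) = 0.\<close>
    also have "\<dots> = (\<Sum>m | m dvd n. vonm (n div m) * weight n)"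
    proof (intro sum.mono_neutral_left ballI)
      fix d assume "d \<in> {m. m dvd n} - ?D"
      then have "d = n" using less.prems dvd_imp_le[of d n] by auto
      then show "vonm (n div d) * weight n = 0" using less.prems by simp
    qed (use less.prems in auto)
    also have "\<dots> = (\<Sum>d | d dvd n. vonm d * weight n)"
    proof -
      have "n div (n div d) = d" "n div d dvd n" if "d dvd n" for d
        using that less.prems by (auto elim!: dvdE)
      then show ?thesis
        by (intro sum.reindex_bij_witness[of _ "\<lambda>d. n div d" "\<lambda>d. n div d"]) simp_all
    qed
    also have "\<dots> = ln (real n) * weight n"
      using mangoldt_sum[of n, where 'a = real] less.prems by (simp add: sum_distrib_right[symmetric])
    finally show ?thesis using False by (simp add: hit_mass_def)
  qed
qed

section \<open>Integers with many prime factors\<close>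

text \<open>
  The difference of the two sides is nonincreasing in s and has nonnegative limit at infinity, so no
  Euler product is needed.
\<close>
lemma sum_primes_powr_le_ln_zeta:
  assumes s: "s > 1" and P: "finite P" "\<And>p. p \<in> P \<Longrightarrow> prime p"
  shows "(\<Sum>p\<in>P. real p powr - s) \<le> ln (zeta_real s)"
proof -
  define \<phi> where "\<phi> = (\<lambda>t. ln (zeta_real t) - (\<Sum>p\<in>P. real p powr - t))"
  have pos: "p > 0" if "p \<in> P" for p using P(2)[OF that] prime_gt_0_nat by blast
  have deriv: "\<exists>y. (\<phi> has_real_derivative y) (at t) \<and> y \<le> 0" if "t > 1" for t
  proof (intro exI conjI)
    have z: "zeta_real t \<ge> 1" by (rule zeta_real_ge_1[OF that])
    show "(\<phi> has_real_derivative
        (- zeta_deriv t / zeta_real t - (\<Sum>p\<in>P. - (ln (real p) * real p powr - t)))) (at t)"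
      unfolding \<phi>_def
    proof (intro DERIV_diff DERIV_sum)
      show "((\<lambda>t. ln (zeta_real t)) has_real_derivative - zeta_deriv t / zeta_real t) (at t)"
        using z by (auto intro!: derivative_eq_intros zeta_real_deriv[OF that])
      show "((\<lambda>t. real p powr - t) has_real_derivative - (ln (real p) * real p powr - t)) (at t)"
        if "p \<in> P" for p
        using pos[OF that] by (auto intro!: derivative_eq_intros simp: powr_def)
    qed
    \<comment> \<open>On primes \<Lambda>(p) = ln p, so \<open>mangoldt_dirichlet_le\<close> gives
      the sign of the derivative.\<close>
    have "(\<Sum>p\<in>P. ln (real p) * real p powr - t) * zeta_real t
        = (\<Sum>p\<in>P. vonm p * real p powr - t) * zeta_real t"
      using P(2) by (intro arg_cong2[where f = "(*)"] sum.cong) auto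
    also have "\<dots> \<le> zeta_deriv t" by (rule mangoldt_dirichlet_le[OF that P(1)])
    finally show "- zeta_deriv t / zeta_real t - (\<Sum>p\<in>P. - (ln (real p) * real p powr - t)) \<le> 0"
      using z by (simp add: sum_negf field_simps)
  qed
  have le: "- (\<Sum>p\<in>P. real p powr - real j) \<le> \<phi> s" if "real j \<ge> s" for j
  proof -
    have "\<phi> (real j) \<le> \<phi> s"
      using that s by (intro DERIV_nonpos_imp_nonincreasing[OF that] deriv) auto
    moreover have "0 \<le> ln (zeta_real (real j))"
      using zeta_real_ge_1[of "real j"] s that by simp
    ultimately show ?thesis by (simp add: \<phi>_def)
  qed
  have "(\<lambda>j. - (\<Sum>p\<in>P. real p powr - real j)) \<longlonglongrightarrow> - (\<Sum>p\<in>P. 0)"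
  proof (intro tendsto_minus tendsto_sum)
    fix p assume "p \<in> P"
    then have "real p > 1" using P(2) prime_gt_1_nat by simp
    then show "(\<lambda>j. real p powr - real j) \<longlonglongrightarrow> 0" by real_asymp
  qed
  then have "- (\<Sum>p\<in>P. 0 :: real) \<le> \<phi> s"
    by (rule LIMSEQ_le_const2) (use le in \<open>auto intro!: exI[of _ "nat \<lceil>s\<rceil>"] simp: nat_le_iff ceiling_le_iff\<close>)
  then show ?thesis by (simp add: \<phi>_def)
qed

text \<open>Rankin's trick with s = 1 + 1 / ln x: passing from 1/p to p^(-s) costs p^(1 / ln x) <= e
  <= 3 for p <= x, and \<zeta>(s) <= 1 + ln x.\<close>

lemma sum_prime_reciprocals_le:
  assumes "x \<ge> 2"
  shows "(\<Sum>p | prime p \<and> p \<le> x. 1 / real p) \<le> 3 * ln (1 + ln (real x))"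
proof -
  let ?P = "{p. prime p \<and> p \<le> x}"
  define L where "L = ln (real x)"
  have L: "L > 0" using assms by (simp add: L_def)
  define s where "s = 1 + 1 / L"
  have s: "s > 1" using L by (simp add: s_def)
  have "(\<Sum>p\<in>?P. 1 / real p) \<le> (\<Sum>p\<in>?P. 3 * real p powr - s)"
  proof (rule sum_mono)
    fix p assume p: "p \<in> ?P"
    then have p1: "real p > 1" using prime_gt_1_nat by auto
    have "ln (real p) \<le> L" using p p1 by (simp add: L_def)
    then have le: "ln (real p) / L \<le> 1" using L by simp
    have "exp (ln (real p) / L) \<le> exp 1" using le by simp
    also have "\<dots> \<le> (3::real)" by (rule exp_le)
    finally have e: "exp (ln (real p) / L) \<le> 3" .
    have "exp (ln (real p) / L) * real p powr - s = exp (ln (real p) / L) * exp (- s * ln (real p))"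
      using p1 by (simp add: powr_def)
    also have "\<dots> = exp (ln (real p) / L + - s * ln (real p))" by (simp only: exp_add)
    also have "ln (real p) / L + - s * ln (real p) = - ln (real p)"
    proof -
      have "s * ln (real p) = ln (real p) + ln (real p) / L" unfolding s_def by (simp add: distrib_right)
      then show ?thesis by simp
    qed
    also have "exp (- ln (real p)) = 1 / real p"
      using p1 by (simp add: exp_minus inverse_eq_divide)
    finally have "1 / real p = exp (ln (real p) / L) * real p powr - s" ..
    also have "\<dots> \<le> 3 * real p powr - s" by (rule mult_right_mono[OF e]) simp
    finally show "1 / real p \<le> 3 * real p powr - s" .
  qed
  also have "\<dots> = 3 * (\<Sum>p\<in>?P. real p powr - s)" by (simp add: sum_distrib_left)
  also have "\<dots> \<le> 3 * ln (zeta_real s)"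
    by (intro mult_left_mono sum_primes_powr_le_ln_zeta s) auto
  also have "\<dots> \<le> 3 * ln (1 + L)"
    using zeta_real_bounds(2)[OF s] zeta_real_ge_1[OF s] L by (simp add: s_def)
  finally show ?thesis by (simp add: L_def)
qed

section \<open>Sums of 1 / (n ln n) and the average number of prime factors\<close>

lemma ln_diff_ge_inverse:
  assumes "n \<ge> 2"
  shows "1 / real (Suc n) \<le> ln (real (Suc n)) - ln (real n)"
proof -
  have "ln (real n / real (Suc n)) \<le> real n / real (Suc n) - 1"
    using assms by (intro ln_le_minus_one) auto
  also have "\<dots> = - (1 / real (Suc n))" by (simp add: field_simps)
  finally show ?thesis using assms by (simp add: ln_div)
qed

text \<open>Compare with the increments of ln ln, using ln t <= t - 1 at t = ln n / ln (n + 1). The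
  constant 2 covers 1 / (2 ln 2) and -ln (ln 2), each at most 1.\<close>

lemma sum_inverse_n_ln_le:
  assumes "k \<ge> 2"
  shows "(\<Sum>n=2..k. 1 / (real n * ln (real n))) \<le> 2 + ln (ln (real k))"
proof -
  have "(\<Sum>n=2..k. 1 / (real n * ln (real n))) \<le> 1 / (2 * ln 2) + ln (ln (real k)) - ln (ln 2)"
    using assms
  proof (induction k rule: nat_induct_at_least)
    case (Suc n)
    let ?l = "ln (real n)" and ?L = "ln (real (Suc n))"
    have l: "?l > 0" "?L > 0" using Suc.hyps by auto
    have "1 / (real (Suc n) * ?L) = (1 / real (Suc n)) / ?L" by simp
    also have "\<dots> \<le> (?L - ?l) / ?L"
      using ln_diff_ge_inverse[OF Suc.hyps] l by (intro divide_right_mono) auto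
    also have "\<dots> = - (?l / ?L - 1)" using l by (simp add: field_simps)
    also have "\<dots> \<le> - ln (?l / ?L)"
      using ln_le_minus_one[of "?l / ?L"] l by simp
    also have "\<dots> = ln ?L - ln ?l" using l by (simp add: ln_div)
    finally show ?case using Suc by simp
  qed simp
  moreover have "1 / (2 * ln 2) \<le> (1::real)"
    using ln2_ge_two_thirds by (simp add: field_simps)
  moreover have "- ln (ln 2) \<le> (1 :: real)"
  proof -
    have "ln (1 / ln 2) \<le> 1 / ln 2 - (1::real)" by (rule ln_le_minus_one) simp
    also have "1 / ln 2 \<le> (3 / 2 :: real)" using ln2_ge_two_thirds by (simp add: field_simps)
    finally show ?thesis by (simp add: ln_div)
  qed
  ultimately show ?thesis by linarith
qed

text \<open>The terms telescope against -1 / ln n. This bounds the total error in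
  \<open>hit_mass_bounds\<close>.\<close>

lemma sum_inverse_n_ln_squared_le:
  assumes "k \<ge> 2"
  shows "(\<Sum>n=2..k. 1 / (real n * (ln (real n))\<^sup>2)) \<le> 3"
proof -
  have "(\<Sum>n=2..k. 1 / (real n * (ln (real n))\<^sup>2)) \<le> 1 / (2 * (ln 2)\<^sup>2) + 1 / ln 2 - 1 / ln (real k)"
    using assms
  proof (induction k rule: nat_induct_at_least)
    case (Suc n)
    let ?l = "ln (real n)" and ?L = "ln (real (Suc n))"
    have l: "?l > 0" "?L > 0" "?l \<le> ?L" using Suc.hyps by auto
    have "1 / (real (Suc n) * ?L\<^sup>2) = (1 / real (Suc n)) / (?L * ?L)" by (simp add: power2_eq_square)
    also have "\<dots> \<le> (?L - ?l) / (?L * ?L)"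
      using ln_diff_ge_inverse[OF Suc.hyps] l by (intro divide_right_mono) auto
    also have "\<dots> \<le> (?L - ?l) / (?l * ?L)"
      using l by (intro divide_left_mono mult_right_mono) auto
    also have "\<dots> = 1 / ?l - 1 / ?L" using l by (simp add: field_simps)
    finally show ?case using Suc by simp
  qed simp
  also have "\<dots> \<le> 1 / (2 * (ln 2)\<^sup>2) + 1 / ln 2" using assms by simp
  also have "\<dots> \<le> 3 / 2 + 3 / 2"
  proof (intro add_mono)
    have "(2 / 3)\<^sup>2 \<le> (ln 2 :: real)\<^sup>2" using ln2_ge_two_thirds by (intro power_mono) auto
    then have "4 / 9 \<le> (ln 2 :: real)\<^sup>2" by (simp add: power2_eq_square)
    then show "1 / (2 * (ln 2)\<^sup>2) \<le> (3 / 2 :: real)" by (simp add: field_simps)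
    show "1 / ln 2 \<le> (3 / 2 :: real)" using ln2_ge_two_thirds by (simp add: field_simps)
  qed
  finally show ?thesis by simp
qed

text \<open>The function \<Omega>. Counting with multiplicity makes it strictly increase along
  proper divisibility.\<close>

definition num_prime_factors :: "nat \<Rightarrow> nat" where
  "num_prime_factors n = size (prime_factorization n)"

lemma num_prime_factors_less:
  assumes "a dvd b" "a < b"
  shows "num_prime_factors a < num_prime_factors b"
proof -
  from assms(1) obtain c where b: "b = a * c" by auto
  then have "a \<noteq> 0" "c \<noteq> 0" "c \<noteq> 1" using assms(2) by auto
  then show ?thesis
    by (simp add: num_prime_factors_def b prime_factorization_mult prime_factorization_empty_iff
        nonempty_has_size[symmetric])
qed

lemma multiplicity_eq_card:
  assumes "prime p" "b \<ge> 1" "b \<le> k"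
  shows "multiplicity p b = card {j\<in>{1..k}. p ^ j dvd b}"
proof -
  have p: "p \<ge> 2" using assms(1) by (rule prime_ge_2_nat)
  have iff: "p ^ j dvd b \<longleftrightarrow> j \<le> multiplicity p b" for j
    using assms p by (intro power_dvd_iff_le_multiplicity) auto
  \<comment> \<open>For the multiplicity v this yields v < 2^v <= p^v <= b <= k, so exponents up to
    k suffice.\<close>
  have "multiplicity p b < 2 ^ multiplicity p b" by simp
  also have "\<dots> \<le> p ^ multiplicity p b" using p by (intro power_mono) auto
  also have "\<dots> \<le> b" using assms iff by (intro dvd_imp_le) auto
  finally have "{j\<in>{1..k}. p ^ j dvd b} = {1..multiplicity p b}"
    using assms by (auto simp: iff)
  then show ?thesis by simp
qed

text \<open>The summation ranges depend on k but not on b, so that the order of summation can be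
  exchanged later.\<close>

lemma num_prime_factors_eq_sum:
  assumes "b \<ge> 1" "b \<le> k"
  shows "real (num_prime_factors b)
    = (\<Sum>p | prime p \<and> p \<le> k. \<Sum>j=1..k. if p ^ j dvd b then 1 else 0)"
proof -
  have "num_prime_factors b = (\<Sum>p\<in>prime_factors b. multiplicity p b)"
    unfolding num_prime_factors_def size_multiset_overloaded_eq
    by (intro sum.cong) (auto simp: count_prime_factorization)
  also have "\<dots> = (\<Sum>p | prime p \<and> p \<le> k. multiplicity p b)"
  proof (intro sum.mono_neutral_left ballI)
    show "prime_factors b \<subseteq> {p. prime p \<and> p \<le> k}"
      using assms by (auto simp: prime_factors_dvd dest: dvd_imp_le)
    fix p assume "p \<in> {p. prime p \<and> p \<le> k} - prime_factors b"
    then show "multiplicity p b = 0"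
      using assms by (auto simp: prime_factors_dvd not_dvd_imp_multiplicity_0)
  qed simp
  also have "\<dots> = (\<Sum>p | prime p \<and> p \<le> k. card {j\<in>{1..k}. p ^ j dvd b})"
    using assms by (intro sum.cong multiplicity_eq_card) auto
  finally show ?thesis
    by (simp add: sum.If_cases Int_def)
qed

lemma sum_multiples_n_ln_le:
  assumes "d \<ge> 2" "k \<ge> 2"
  shows "(\<Sum>b | b \<in> {2..k} \<and> d dvd b. 1 / (real b * ln (real b))) \<le> (4 + ln (ln (real k))) / real d"
proof -
  have "(\<Sum>b | b \<in> {2..k} \<and> d dvd b. 1 / (real b * ln (real b)))
      \<le> (\<Sum>b\<in>(\<lambda>m. d * m) ` {1..k}. 1 / (real b * ln (real b)))"
  proof (rule sum_mono2)
    show "{b. b \<in> {2..k} \<and> d dvd b} \<subseteq> (\<lambda>m. d * m) ` {1..k}"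
    proof
      fix b assume "b \<in> {b. b \<in> {2..k} \<and> d dvd b}"
      then obtain m where m: "b = d * m" "2 \<le> b" "b \<le> k" by auto
      from m have "m \<noteq> 0" by (intro notI) simp
      have "1 * m \<le> d * m" using assms by (intro mult_right_mono) auto
      then have "m \<le> k" using m by linarith
      with \<open>m \<noteq> 0\<close> show "b \<in> (\<lambda>m. d * m) ` {1..k}"
        using m(1) by (intro image_eqI[of _ _ m]) auto
    qed
    fix b assume "b \<in> (\<lambda>m. d * m) ` {1..k} - {b. b \<in> {2..k} \<and> d dvd b}"
    then have "b \<ge> 1" using assms by auto
    then show "0 \<le> 1 / (real b * ln (real b))" by simp
  qed simp
  also have "\<dots> = (\<Sum>m=1..k. 1 / (real (d * m) * ln (real (d * m))))"
    using assms by (subst sum.reindex) (auto simp: inj_on_def)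
  \<comment> \<open>The term m = 1 is separated because ln (d * m) >= ln m is useless there; it is
    bounded by ln d >= 2/3 instead.\<close>
  also have "\<dots> = 1 / (real d * ln (real d)) + (\<Sum>m=2..k. 1 / (real (d * m) * ln (real (d * m))))"
    using assms by (subst sum.atLeast_Suc_atMost) (auto simp: numeral_2_eq_2)
  also have "\<dots> \<le> 2 / real d + (\<Sum>m=2..k. (1 / (real m * ln (real m))) / real d)"
  proof (intro add_mono sum_mono)
    have "2 / 3 \<le> ln (real d)"
      using ln2_ge_two_thirds assms by (intro order.trans[OF ln2_ge_two_thirds]) simp
    then show "1 / (real d * ln (real d)) \<le> 2 / real d"
      using assms by (simp add: field_simps)
    fix m assume m: "m \<in> {2..k}"
    have "m \<le> d * m" using assms by simp
    then have "ln (real m) \<le> ln (real (d * m))" using m by (simp del: of_nat_mult)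
    moreover have "ln (real m) > 0" "real (d * m) > 0" using m assms by simp_all
    ultimately have "1 / (real (d * m) * ln (real (d * m))) \<le> 1 / (real (d * m) * ln (real m))"
      using m assms by (intro divide_left_mono mult_left_mono mult_pos_pos) linarith+
    also have "\<dots> = (1 / (real m * ln (real m))) / real d" by simp
    finally show "1 / (real (d * m) * ln (real (d * m))) \<le> (1 / (real m * ln (real m))) / real d" .
  qed
  also have "\<dots> = (2 + (\<Sum>m=2..k. 1 / (real m * ln (real m)))) / real d"
    by (simp add: sum_divide_distrib add_divide_distrib)
  also have "\<dots> \<le> (2 + (2 + ln (ln (real k)))) / real d"
    using sum_inverse_n_ln_le[OF assms(2)] by (intro divide_right_mono add_left_mono) auto
  finally show ?thesis by simp
qed

lemma sum_inverse_powers_le: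
  fixes p :: nat
  assumes "p \<ge> 2"
  shows "(\<Sum>j=1..k. 1 / real (p ^ j)) \<le> 2 / real p"
proof -
  \<comment> \<open>Subtracting a tail makes the induction close; the step uses 2 / p <= 1.\<close>
  have "(\<Sum>j=1..k. 1 / real (p ^ j)) \<le> 2 / real p - 1 / real (p ^ k) * (2 / real p)"
  proof (induction k)
    case (Suc k)
    have "1 / real (p ^ Suc k) + 1 / real (p ^ Suc k) * (2 / real p) \<le> 1 / real (p ^ k) * (2 / real p)"
    proof -
      have "1 / real (p ^ Suc k) * (2 / real p) \<le> 1 / real (p ^ Suc k) * 1"
        using assms by (intro mult_left_mono) auto
      moreover have "1 / real (p ^ k) * (2 / real p) = 2 * (1 / real (p ^ Suc k))"
        by (simp add: mult.commute)
      ultimately show ?thesis by linarith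
    qed
    then show ?case using Suc by simp
  qed simp
  also have "\<dots> \<le> 2 / real p" by simp
  finally show ?thesis .
qed

text \<open>The threshold is 2^5 because 5 ln 2 >= 10/3 > e.\<close>

lemma loglog_ge_1:
  assumes "k \<ge> 32"
  shows "1 \<le> ln (ln (real k))"
proof -
  have "exp 1 \<le> (3 :: real)" by (rule exp_le)
  also have "3 \<le> 5 * ln (2::real)" using ln2_ge_two_thirds by simp
  also have "\<dots> = ln (2 ^ 5 :: real)" by (simp only: ln_realpow)
  also have "\<dots> \<le> ln (real k)" using assms by simp
  finally have "exp 1 \<le> ln (real k)" .
  moreover have "0 < ln (real k)" using assms by simp
  ultimately show ?thesis by (simp add: ln_ge_iff)
qed

text \<open>Count prime powers dividing b, exchange the sums, and apply
  \<open>sum_multiples_n_ln_le\<close> to each p^j. With LL = ln ln k, the 60 is 5 * 2 * 3 * 2: from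
  4 + LL <= 5 LL, the geometric series, the prime sum, and ln (1 + ln k) <= 2 LL.\<close>

lemma sum_num_prime_factors_le:
  assumes "k \<ge> 32"
  shows "(\<Sum>b=2..k. real (num_prime_factors b) / (real b * ln (real b))) \<le> 60 * (ln (ln (real k)))\<^sup>2"
proof -
  let ?P = "{p. prime p \<and> p \<le> k}"
  let ?g = "\<lambda>b. 1 / (real b * ln (real b))"
  define LL where "LL = ln (ln (real k))"
  have LL: "LL \<ge> 1" using loglog_ge_1[OF assms] by (simp add: LL_def)
  have k: "k \<ge> 2" using assms by simp
  have "(\<Sum>b=2..k. real (num_prime_factors b) / (real b * ln (real b)))
      = (\<Sum>b=2..k. \<Sum>p\<in>?P. \<Sum>j=1..k. if p ^ j dvd b then ?g b else 0)"
  proof (rule sum.cong)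
    fix b assume b: "b \<in> {2..k}"
    have "real (num_prime_factors b) / (real b * ln (real b)) = real (num_prime_factors b) * ?g b" by simp
    also have "\<dots> = (\<Sum>p\<in>?P. \<Sum>j=1..k. if p ^ j dvd b then ?g b else 0)"
      using b by (subst num_prime_factors_eq_sum[of b k])
        (simp_all add: sum_distrib_right if_distrib[where f = "\<lambda>x. x * ?g b"] cong: if_cong del: times_divide_eq_right)
    finally show "real (num_prime_factors b) / (real b * ln (real b))
      = (\<Sum>p\<in>?P. \<Sum>j=1..k. if p ^ j dvd b then ?g b else 0)" .
  qed simp
  also have "\<dots> = (\<Sum>p\<in>?P. \<Sum>j=1..k. \<Sum>b=2..k. if p ^ j dvd b then ?g b else 0)"
    by (subst sum.swap, rule sum.cong[OF refl], rule sum.swap)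
  also have "\<dots> \<le> (\<Sum>p\<in>?P. \<Sum>j=1..k. (4 + LL) / real (p ^ j))"
  proof (intro sum_mono)
    fix p j assume p: "p \<in> ?P" and j: "j \<in> {1..k}"
    have "2 ^ 1 \<le> (2::nat) ^ j" using j by (intro power_increasing) auto
    also have "\<dots> \<le> p ^ j" using p prime_ge_2_nat by (intro power_mono) auto
    finally have "(\<Sum>b | b \<in> {2..k} \<and> p ^ j dvd b. ?g b) \<le> (4 + LL) / real (p ^ j)"
      unfolding LL_def using k by (intro sum_multiples_n_ln_le) auto
    then show "(\<Sum>b=2..k. if p ^ j dvd b then ?g b else 0) \<le> (4 + LL) / real (p ^ j)"
      by (simp add: sum.If_cases Int_def)
  qed
  also have "\<dots> = (\<Sum>p\<in>?P. (4 + LL) * (\<Sum>j=1..k. 1 / real (p ^ j)))"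
    by (simp add: sum_distrib_left)
  also have "\<dots> \<le> (\<Sum>p\<in>?P. (4 + LL) * (2 / real p))"
    using LL prime_ge_2_nat by (intro sum_mono mult_left_mono sum_inverse_powers_le) auto
  also have "\<dots> = (4 + LL) * 2 * (\<Sum>p\<in>?P. 1 / real p)"
    by (simp add: sum_distrib_left mult_ac)
  also have "\<dots> \<le> (4 + LL) * 2 * (3 * ln (1 + ln (real k)))"
    using LL sum_prime_reciprocals_le[OF k] by (intro mult_left_mono) auto
  also have "\<dots> \<le> (5 * LL) * 2 * (3 * (2 * LL))"
  proof -
    have lk: "ln (real k) \<ge> 1" using LL assms ln_le_minus_one[of "ln (real k)"] by (simp add: LL_def)
    then have "ln (1 + ln (real k)) \<le> ln (2 * ln (real k))" by simp
    also have "\<dots> = ln 2 + LL" using lk by (simp add: ln_mult LL_def)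
    also have "\<dots> \<le> 2 * LL" using ln_2_less_1 LL by simp
    finally have "ln (1 + ln (real k)) \<le> 2 * LL" .
    then show ?thesis using LL lk by (intro mult_mono) auto
  qed
  also have "\<dots> = 60 * LL\<^sup>2" by (simp add: power2_eq_square)
  finally show ?thesis by (simp add: LL_def)
qed

section \<open>Existence of a dense trajectory\<close>

definition loglog_mean :: "nat set \<Rightarrow> nat \<Rightarrow> real" where
  "loglog_mean A k = (\<Sum>a | a \<in> A \<and> 2 \<le> a \<and> a \<le> k. 1 / (real a * ln (real a))) / ln (ln (real k))"

definition loglog_count :: "nat set \<Rightarrow> nat \<Rightarrow> real" where
  "loglog_count B k = real (card {a\<in>B. a \<le> k}) / ln (ln (real k))"

text \<open>Rounding x down keeps the numerator and does not increase the denominator, so a bound at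
  all large integers would extend to all large reals.\<close>

lemma frequently_loglog_mean:
  assumes "ereal c < Delta A"
  shows "\<exists>\<^sub>F k in sequentially. c < loglog_mean A k"
proof (rule ccontr)
  assume "\<not> ?thesis"
  then have "\<forall>\<^sub>F k in sequentially. loglog_mean A k \<le> c"
    by (simp add: not_frequently not_less)
  then obtain N where N: "\<And>k. k \<ge> N \<Longrightarrow> loglog_mean A k \<le> c"
    by (auto simp: eventually_sequentially)
  have "\<forall>\<^sub>F x in at_top. ereal ((\<Sum>a\<in>{a\<in>A. 2 \<le> a \<and> real a \<le> x}. 1 / (real a * ln (real a))) / ln (ln x)) \<le> ereal c"
    using eventually_ge_at_top[of "real (max N 32)"]
  proof eventually_elim
    case (elim x)
    define k where "k = nat \<lfloor>x\<rfloor>"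
    have k: "k \<ge> N" "k \<ge> 32" "real k \<le> x" using elim by (auto simp: k_def le_nat_floor)
    let ?S = "\<Sum>a | a \<in> A \<and> 2 \<le> a \<and> a \<le> k. 1 / (real a * ln (real a))"
    have S: "0 \<le> ?S" by (intro sum_nonneg) auto
    have "real a \<le> x \<longleftrightarrow> a \<le> k" for a
      using le_nat_floor[of a x] k(3) of_nat_mono[of a k, where 'a = real] by (auto simp: k_def)
    then have eq: "{a\<in>A. 2 \<le> a \<and> real a \<le> x} = {a. a \<in> A \<and> 2 \<le> a \<and> a \<le> k}"
      by simp
    have "1 \<le> ln (ln (real k))" by (rule loglog_ge_1[OF k(2)])
    moreover have "ln (ln (real k)) \<le> ln (ln x)" using k by simp
    ultimately have "?S / ln (ln x) \<le> ?S / ln (ln (real k))"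
      using S by (intro divide_left_mono mult_pos_pos) auto
    also have "\<dots> \<le> c" using N[OF k(1)] by (simp add: loglog_mean_def)
    finally show ?case unfolding eq by simp
  qed
  then have "Delta A \<le> ereal c" unfolding Delta_def by (rule Limsup_bounded)
  with assms show False by simp
qed

lemma chain_density_ge:
  assumes "\<exists>\<^sub>F k in sequentially. c < loglog_count (range n) k" "inj n"
  shows "ereal c \<le> chain_density n"
proof (rule ccontr)
  assume "\<not> ?thesis"
  then have "chain_density n < ereal c" by simp
  then have "\<forall>\<^sub>F x in at_top. ereal (real (card {i. real (n i) \<le> x}) / ln (ln x)) < ereal c"
    unfolding chain_density_def by (rule Limsup_lessD)
  then have "\<forall>\<^sub>F k in sequentially. ereal (real (card {i. real (n i) \<le> real k}) / ln (ln (real k))) < ereal c"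
    by (rule eventually_compose_filterlim) (rule filterlim_real_sequentially)
  moreover have "card {i. real (n i) \<le> real k} = card {a \<in> range n. a \<le> k}" for k
  proof -
    have "{a \<in> range n. a \<le> k} = n ` {i. real (n i) \<le> real k}" by auto
    then show ?thesis using assms(2) by (simp add: card_image inj_on_def)
  qed
  ultimately have "\<forall>\<^sub>F k in sequentially. \<not> c < loglog_count (range n) k"
    by (auto simp: loglog_count_def elim!: eventually_mono)
  then show False using assms(1) by (simp add: frequently_def)
qed

text \<open>Finiteness allows the main argument to treat \<open>Delta A\<close> as a real
  number.\<close>

lemma Delta_le_3: "Delta A \<le> 3"
proof (rule ccontr)
  assume "\<not> ?thesis"
  then have "ereal 3 < Delta A" by simp
  from frequently_loglog_mean[OF this] have "\<exists>\<^sub>F k in sequentially. 3 < loglog_mean A k" .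
  moreover have "\<forall>\<^sub>F k in sequentially. \<not> 3 < loglog_mean A k"
    using eventually_ge_at_top[of 32]
  proof eventually_elim
    case (elim k)
    have L: "1 \<le> ln (ln (real k))" by (rule loglog_ge_1[OF elim])
    have "(\<Sum>a | a \<in> A \<and> 2 \<le> a \<and> a \<le> k. 1 / (real a * ln (real a))) \<le> (\<Sum>a=2..k. 1 / (real a * ln (real a)))"
      by (rule sum_mono2) auto
    also have "\<dots> \<le> 2 + ln (ln (real k))" using elim by (intro sum_inverse_n_ln_le) auto
    also have "\<dots> \<le> 3 * ln (ln (real k))" using L by simp
    finally show ?case using L by (simp add: loglog_mean_def divide_le_eq not_less)
  qed
  ultimately show False by (simp add: frequently_def)
qed

section \<open>Expected counts and the reverse Fatou argument\<close>

lemma nn_integral_hit_count: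
  assumes F: "finite F" "\<And>a. a \<in> F \<Longrightarrow> a \<ge> 1" and L: "L > 0"
  shows "(\<integral>\<^sup>+ w. ennreal (real (card {a\<in>F. hit w a}) / L) \<partial>step_space UNIV)
    = ennreal ((\<Sum>a\<in>F. hit_mass a) / L)"
    and "(\<lambda>w. ennreal (real (card {a\<in>F. hit w a}) / L)) \<in> borel_measurable (step_space UNIV)"
proof -
  interpret prob_space "step_space UNIV" by (rule prob_space_step_space)
  have meas [measurable]: "{w. hit w a} \<in> sets (step_space UNIV)" for a
    using sets_hit[of a UNIV] by simp
  have eq: "ennreal (real (card {a\<in>F. hit w a}) / L) = (\<Sum>a\<in>F. ennreal (1 / L) * indicator {w. hit w a} w)" for w
  proof -
    have "real (card {a\<in>F. hit w a}) = (\<Sum>a\<in>F. indicator {w. hit w a} w)"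
      using F by (simp add: indicator_def sum.If_cases Int_def)
    then have "real (card {a\<in>F. hit w a}) / L = (\<Sum>a\<in>F. 1 / L * indicator {w. hit w a} w)"
      by (simp add: sum_divide_distrib)
    then have "ennreal (real (card {a\<in>F. hit w a}) / L) = (\<Sum>a\<in>F. ennreal (1 / L * indicator {w. hit w a} w))"
      using L by (subst sum_ennreal) simp_all
    also have "\<dots> = (\<Sum>a\<in>F. ennreal (1 / L) * indicator {w. hit w a} w)"
      by (intro sum.cong) (auto simp: indicator_def)
    finally show ?thesis .
  qed
  show "(\<lambda>w. ennreal (real (card {a\<in>F. hit w a}) / L)) \<in> borel_measurable (step_space UNIV)"
    unfolding eq by measurable
  have "(\<integral>\<^sup>+ w. ennreal (real (card {a\<in>F. hit w a}) / L) \<partial>step_space UNIV)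
      = (\<Sum>a\<in>F. ennreal (1 / L) * emeasure (step_space UNIV) {w. hit w a})"
    unfolding eq by (subst nn_integral_sum) (simp_all add: nn_integral_cmult_indicator)
  also have "\<dots> = (\<Sum>a\<in>F. ennreal (hit_mass a / L))"
    using F L by (intro sum.cong)
      (auto simp: emeasure_eq_measure prob_hit ennreal_mult[symmetric] hit_mass_nonneg)
  also have "\<dots> = ennreal ((\<Sum>a\<in>F. hit_mass a) / L)"
    using F L by (subst sum_ennreal) (auto simp: hit_mass_nonneg sum_divide_distrib)
  finally show "(\<integral>\<^sup>+ w. ennreal (real (card {a\<in>F. hit w a}) / L) \<partial>step_space UNIV)
    = ennreal ((\<Sum>a\<in>F. hit_mass a) / L)" .
qed

text \<open>The 6 is the total error of \<open>hit_mass_bounds\<close>. The 60 / K is Markov's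
  inequality: each discarded a has \<Omega>(a) >= K ln ln k, so its mass may be multiplied by
  \<Omega>(a) / (K ln ln k) and summed with \<open>sum_num_prime_factors_le\<close>.\<close>

lemma sum_hit_mass_ge:
  assumes k: "k \<ge> 32" and K: "K > 0"
  shows "loglog_mean A k - 6 / ln (ln (real k)) - 60 / K
    \<le> (\<Sum>a | a \<in> A \<and> 2 \<le> a \<and> a \<le> k \<and> real (num_prime_factors a) \<le> K * ln (ln (real k)). hit_mass a)
        / ln (ln (real k))"
proof -
  define LL where "LL = ln (ln (real k))"
  have LL: "LL \<ge> 1" unfolding LL_def by (rule loglog_ge_1[OF k])
  let ?B = "{a. a \<in> A \<and> 2 \<le> a \<and> a \<le> k}"
  let ?F = "{a. a \<in> A \<and> 2 \<le> a \<and> a \<le> k \<and> real (num_prime_factors a) \<le> K * LL}"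
  have fin: "finite ?B" by (rule finite_subset[of _ "{..k}"]) auto
  have "(\<Sum>a\<in>?B. 1 / (real a * ln (real a))) - 6 \<le> (\<Sum>a\<in>?B. hit_mass a)"
  proof -
    have "(\<Sum>a\<in>?B. 2 * (1 / (real a * (ln (real a))\<^sup>2))) \<le> (\<Sum>a=2..k. 2 * (1 / (real a * (ln (real a))\<^sup>2)))"
      by (rule sum_mono2) auto
    also have "\<dots> \<le> 2 * 3"
      unfolding sum_distrib_left[symmetric] using k by (intro mult_left_mono sum_inverse_n_ln_squared_le) auto
    finally have "(\<Sum>a\<in>?B. 2 * (1 / (real a * (ln (real a))\<^sup>2))) \<le> 6" by simp
    moreover have "(\<Sum>a\<in>?B. 1 / (real a * ln (real a)) - 2 * (1 / (real a * (ln (real a))\<^sup>2))) \<le> (\<Sum>a\<in>?B. hit_mass a)"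
      using hit_mass_bounds(2) by (intro sum_mono) simp
    ultimately show ?thesis unfolding sum_subtractf by linarith
  qed
  moreover have "(\<Sum>a\<in>?B. hit_mass a) = (\<Sum>a\<in>?F. hit_mass a) + (\<Sum>a\<in>?B - ?F. hit_mass a)"
    using fin by (subst add.commute, intro sum.subset_diff) auto
  moreover have "(\<Sum>a\<in>?B - ?F. hit_mass a) \<le> 60 * LL / K"
  proof -
    have "(\<Sum>a\<in>?B - ?F. hit_mass a) \<le> (\<Sum>a\<in>?B - ?F. real (num_prime_factors a) / (real a * ln (real a)) / (K * LL))"
    proof (rule sum_mono)
      fix a assume a: "a \<in> ?B - ?F"
      then have npf: "K * LL \<le> real (num_prime_factors a)" by auto
      have "hit_mass a \<le> 1 / (real a * ln (real a))" using a by (intro hit_mass_bounds) auto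
      also have "\<dots> = (K * LL) / (real a * ln (real a)) / (K * LL)" using K LL by simp
      also have "\<dots> \<le> real (num_prime_factors a) / (real a * ln (real a)) / (K * LL)"
        using npf K LL a by (intro divide_right_mono) auto
      finally show "hit_mass a \<le> real (num_prime_factors a) / (real a * ln (real a)) / (K * LL)" .
    qed
    also have "\<dots> \<le> (\<Sum>a=2..k. real (num_prime_factors a) / (real a * ln (real a)) / (K * LL))"
      using K LL by (intro sum_mono2) auto
    also have "\<dots> \<le> 60 * LL\<^sup>2 / (K * LL)"
      unfolding sum_divide_distrib[symmetric] LL_def[symmetric]
      using sum_num_prime_factors_le[OF k] K LL by (intro divide_right_mono) (auto simp: LL_def)
    also have "\<dots> = 60 * LL / K" using LL by (simp add: power2_eq_square)
    finally show ?thesis .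
  qed
  ultimately have "(\<Sum>a\<in>?B. 1 / (real a * ln (real a))) - 6 - 60 * LL / K \<le> (\<Sum>a\<in>?F. hit_mass a)"
    by linarith
  then have "((\<Sum>a\<in>?B. 1 / (real a * ln (real a))) - 6 - 60 * LL / K) / LL \<le> (\<Sum>a\<in>?F. hit_mass a) / LL"
    using LL by (intro divide_right_mono) auto
  then show ?thesis using LL by (simp add: loglog_mean_def LL_def[symmetric] diff_divide_distrib)
qed

text \<open>Visited integers divide one another in order, so \<Omega> separates them. Being uniform
  in w, the bound supplies the majorant for the reverse Fatou lemma.\<close>

lemma card_hits_le:
  assumes "R \<ge> 0"
  shows "real (card {a\<in>F. real (num_prime_factors a) \<le> R \<and> hit w a}) \<le> R + 1"
proof -
  let ?H = "{a\<in>F. real (num_prime_factors a) \<le> R \<and> hit w a}"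
  have "inj_on num_prime_factors ?H"
  proof (rule linorder_inj_onI)
    fix a b assume "a < b" "a \<in> ?H" "b \<in> ?H"
    then show "num_prime_factors a \<noteq> num_prime_factors b"
      using hit_dvd[of w a b] num_prime_factors_less[of a b] by auto
  qed auto
  moreover have "num_prime_factors ` ?H \<subseteq> {..nat \<lfloor>R\<rfloor>}"
    by (auto simp: le_nat_floor)
  ultimately have "card ?H \<le> card {..nat \<lfloor>R\<rfloor>}" by (intro card_inj_on_le) auto
  then show ?thesis using assms by simp linarith
qed

text \<open>If G < d everywhere, then d - G has integral 0, hence vanishes almost everywhere, a
  contradiction. Reaching d itself lets a single trajectory serve every c < d.\<close>

lemma (in prob_space) exists_ge_nn_integral:
  assumes [measurable]: "G \<in> borel_measurable M" and d: "ennreal d \<le> (\<integral>\<^sup>+ w. G w \<partial>M)"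
  shows "\<exists>w\<in>space M. ennreal d \<le> G w"
proof (rule ccontr)
  assume "\<not> ?thesis"
  then have lt: "G w < ennreal d" if "w \<in> space M" for w using that by (auto simp: not_le)
  have "(\<integral>\<^sup>+ w. G w \<partial>M) \<le> (\<integral>\<^sup>+ w. ennreal d \<partial>M)"
    by (rule nn_integral_mono) (rule less_imp_le[OF lt])
  then have fin: "(\<integral>\<^sup>+ w. G w \<partial>M) \<noteq> \<infinity>" by (auto simp: emeasure_space_1 top_unique)
  have "(\<integral>\<^sup>+ w. (ennreal d - G w) \<partial>M) = (\<integral>\<^sup>+ w. ennreal d \<partial>M) - (\<integral>\<^sup>+ w. G w \<partial>M)"
  proof (rule nn_integral_diff)
    show "AE w in M. G w \<le> ennreal d" by (rule AE_I2) (rule less_imp_le[OF lt])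
  qed (use fin in auto)
  also have "\<dots> = 0" using d by (simp add: emeasure_space_1 diff_eq_0_iff_ennreal less_top)
  finally have "AE w in M. ennreal d - G w = 0"
    by (subst (asm) nn_integral_0_iff_AE) auto
  moreover have "AE w in M. ennreal d - G w \<noteq> 0"
  proof (rule AE_I2)
    fix w assume "w \<in> space M"
    from lt[OF this] show "ennreal d - G w \<noteq> 0" by (simp add: diff_eq_0_iff_ennreal not_le)
  qed
  ultimately have "AE w in M. False" by eventually_elim simp
  then show False by simp
qed

lemma limsup_ge_if_frequently:
  fixes f :: "nat \<Rightarrow> ennreal"
  assumes "\<exists>\<^sub>F k in sequentially. c \<le> f k"
  shows "c \<le> limsup f"
proof (rule ccontr)
  assume "\<not> ?thesis"
  then have "\<forall>\<^sub>F k in sequentially. f k < c" by (intro Limsup_lessD) simp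
  then show False using assms by (simp add: frequently_def not_le)
qed

text \<open>The losses are sent to 0 in the bound for the mean of the upper limit, and w is chosen
  only afterwards, so it does not depend on c.\<close>

lemma exists_dense_hit_path:
  assumes d: "0 < d" "Delta A = ereal d"
  shows "\<exists>w. \<forall>c<d. \<exists>\<^sub>F k in sequentially. c < loglog_count {a\<in>A. 2 \<le> a \<and> hit w a} k"
proof -
  interpret prob_space "step_space UNIV" by (rule prob_space_step_space)
  let ?F = "\<lambda>k. {a. a \<in> A \<and> 2 \<le> a \<and> a \<le> k}"
  let ?LL = "\<lambda>k. ln (ln (real k))"
  let ?H = "\<lambda>w. {a\<in>A. 2 \<le> a \<and> hit w a}"
  \<comment> \<open>The shift by 32 makes ln ln at least 1 for every k, as domination is required at
    all indices.\<close>
  define g where "g = (\<lambda>k w. ennreal (real (card {a\<in>?F (k + 32). hit w a}) / ?LL (k + 32)))"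
  define G where "G = (\<lambda>w. limsup (\<lambda>k. g k w))"
  have LL: "?LL (k + 32) \<ge> 1" for k by (rule loglog_ge_1) simp
  have LL0: "?LL (k + 32) > 0" for k using LL[of k] by linarith
  have fin: "finite (?F k)" for k by (rule finite_subset[of _ "{..k}"]) auto
  have g_meas [measurable]: "g k \<in> borel_measurable (step_space UNIV)" for k
    unfolding g_def by (rule nn_integral_hit_count(2)) (use fin LL0 in auto)
  have G_meas [measurable]: "G \<in> borel_measurable (step_space UNIV)"
    unfolding G_def by measurable
  have int: "ennreal (c - e - 60 / K) \<le> (\<integral>\<^sup>+ w. G w \<partial>step_space UNIV)"
    if c: "c < d" and e: "e > 0" and K: "K > 0" for c e K
  proof -
    let ?F' = "\<lambda>k. {a. a \<in> A \<and> 2 \<le> a \<and> a \<le> k \<and> real (num_prime_factors a) \<le> K * ?LL k}"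
    define u where "u = (\<lambda>k w. ennreal (real (card {a\<in>?F' (k + 32). hit w a}) / ?LL (k + 32)))"
    have fin': "finite (?F' k)" for k by (rule finite_subset[OF _ fin[of k]]) auto
    have u_int: "(\<integral>\<^sup>+ w. u k w \<partial>step_space UNIV) = ennreal ((\<Sum>a\<in>?F' (k + 32). hit_mass a) / ?LL (k + 32))" for k
      unfolding u_def by (rule nn_integral_hit_count(1)) (use fin' LL0 in auto)
    have u_meas: "u k \<in> borel_measurable (step_space UNIV)" for k
      unfolding u_def by (rule nn_integral_hit_count(2)) (use fin' LL0 in auto)
    have u_le: "u k w \<le> ennreal (K + 1)" for k w
    proof -
      have "real (card {a\<in>?F' (k + 32). hit w a}) \<le> K * ?LL (k + 32) + 1"
      proof -
        have "{a\<in>?F' (k + 32). hit w a} = {a\<in>?F (k + 32). real (num_prime_factors a) \<le> K * ?LL (k + 32) \<and> hit w a}"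
          by auto
        then show ?thesis using card_hits_le[of "K * ?LL (k + 32)" "?F (k + 32)" w] K LL0[of k] by simp
      qed
      also have "\<dots> \<le> (K + 1) * ?LL (k + 32)" using LL[of k] by (simp add: distrib_right)
      finally show ?thesis
        unfolding u_def using LL0[of k] by (intro ennreal_leI) (simp add: divide_le_eq)
    qed
    have u_le_g: "u k w \<le> g k w" for k w
      unfolding u_def g_def using LL0[of k] fin[of "k + 32"]
      by (intro ennreal_leI divide_right_mono) (auto intro!: card_mono)
    have "\<exists>\<^sub>F k in sequentially. ennreal (c - e - 60 / K) \<le> (\<integral>\<^sup>+ w. u k w \<partial>step_space UNIV)"
    proof -
      have "\<exists>\<^sub>F k in sequentially. c < loglog_mean A k"
        using c d by (intro frequently_loglog_mean) simp
      moreover have "\<forall>\<^sub>F k in sequentially. 6 / ?LL k < e"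
        using e by real_asymp
      ultimately have "\<exists>\<^sub>F k in sequentially. c < loglog_mean A k \<and> 6 / ?LL k < e"
        by (auto elim!: frequently_rev_mp eventually_mono)
      then have "\<exists>\<^sub>F k in sequentially. c < loglog_mean A (k + 32) \<and> 6 / ?LL (k + 32) < e"
        unfolding frequently_def
        using eventually_sequentially_seg[of "\<lambda>k. \<not> (c < loglog_mean A k \<and> 6 / ?LL k < e)" 32] by blast
      then show ?thesis
      proof (rule frequently_elim1)
        fix k assume "c < loglog_mean A (k + 32) \<and> 6 / ?LL (k + 32) < e"
        then show "ennreal (c - e - 60 / K) \<le> (\<integral>\<^sup>+ w. u k w \<partial>step_space UNIV)"
          unfolding u_int using sum_hit_mass_ge[of "k + 32" K A] K by (intro ennreal_leI) simp
      qed
    qed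
    then have "ennreal (c - e - 60 / K) \<le> limsup (\<lambda>k. \<integral>\<^sup>+ w. u k w \<partial>step_space UNIV)"
      by (rule limsup_ge_if_frequently)
    \<comment> \<open>Reverse Fatou: the constant majorant K + 1 is integrable on a probability
      space.\<close>
    also have "\<dots> \<le> (\<integral>\<^sup>+ w. limsup (\<lambda>k. u k w) \<partial>step_space UNIV)"
      by (rule nn_integral_limsup[where w = "\<lambda>_. ennreal (K + 1)"])
        (use u_meas u_le emeasure_space_1 in \<open>auto simp: ennreal_mult_less_top\<close>)
    also have "\<dots> \<le> (\<integral>\<^sup>+ w. G w \<partial>step_space UNIV)"
      unfolding G_def by (intro nn_integral_mono Limsup_mono) (auto simp: u_le_g)
    finally show ?thesis .
  qed
  have "ennreal d \<le> (\<integral>\<^sup>+ w. G w \<partial>step_space UNIV)"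
  proof (rule ennreal_le_epsilon)
    fix e :: real assume e: "e > 0"
    define h where "h = e / 3"
    have h: "h > 0" "e = 3 * h" using e by (auto simp: h_def)
    \<comment> \<open>The choices c = d - h, e = h and K = 60 / h each lose h. The
      \<open>max 0\<close> mirrors how \<open>ennreal\<close> truncates negative reals.\<close>
    have "ennreal d \<le> ennreal (max 0 (d - h - h - 60 / (60 / h)) + e)"
      using h by (intro ennreal_leI) simp
    also have "\<dots> = ennreal (d - h - h - 60 / (60 / h)) + ennreal e"
      using e by (subst ennreal_plus) (auto simp: ennreal_max_0)
    also have "\<dots> \<le> (\<integral>\<^sup>+ w. G w \<partial>step_space UNIV) + ennreal e"
      using h by (intro add_right_mono int) auto
    finally show "ennreal d \<le> (\<integral>\<^sup>+ w. G w \<partial>step_space UNIV) + ennreal e" .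
  qed
  from exists_ge_nn_integral[OF G_meas this] obtain w where w: "ennreal d \<le> G w" by auto
  have "\<exists>\<^sub>F k in sequentially. c < loglog_count (?H w) k" if c: "c < d" for c
  proof (rule ccontr)
    assume "\<not> ?thesis"
    then have "\<forall>\<^sub>F k in sequentially. loglog_count (?H w) k \<le> c"
      by (simp add: not_frequently not_less)
    then have "\<forall>\<^sub>F k in sequentially. loglog_count (?H w) (k + 32) \<le> c"
      by (rule sequentially_offset)
    then have "\<forall>\<^sub>F k in sequentially. g k w \<le> ennreal c"
    proof eventually_elim
      case (elim k)
      have "{a\<in>?F (k + 32). hit w a} = {a\<in>?H w. a \<le> k + 32}" by auto
      then show ?case unfolding g_def using elim
        by (intro ennreal_leI) (simp add: loglog_count_def)
    qed
    then have "G w \<le> ennreal c" unfolding G_def by (rule Limsup_bounded)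
    also have "\<dots> < ennreal d" using c d by (intro ennreal_lessI) auto
    finally show False using w by simp
  qed
  then show ?thesis by blast
qed

text \<open>A bounded count divided by ln ln k tends to 0. Infinitude is what makes
  \<open>enumerate\<close> strictly increasing.\<close>

lemma infinite_if_frequently_loglog_count:
  assumes "\<exists>\<^sub>F k in sequentially. c < loglog_count B k" "c > 0"
  shows "infinite B"
proof
  assume B: "finite B"
  have "\<forall>\<^sub>F k in sequentially. real (card B) / ln (ln (real k)) < c"
    using assms(2) by real_asymp
  moreover have "\<forall>\<^sub>F k in sequentially. loglog_count B k \<le> real (card B) / ln (ln (real k))"
    using eventually_ge_at_top[of 32]
  proof eventually_elim
    case (elim k)
    have "card {a\<in>B. a \<le> k} \<le> card B" using B by (intro card_mono) auto
    then show ?case unfolding loglog_count_def using loglog_ge_1[OF elim]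
      by (intro divide_right_mono) auto
  qed
  ultimately have "\<forall>\<^sub>F k in sequentially. \<not> c < loglog_count B k"
    by eventually_elim simp
  then show False using assms(1) by (simp add: frequently_def)
qed

theorem theorem1p6:
  fixes A :: "nat set"
  assumes "A \<subseteq> {1..}"
    and "Delta A > 0"
  shows "\<exists>n :: nat \<Rightarrow> nat. strict_mono n \<and> (\<forall>i. n i \<in> A) \<and> (\<forall>i. n i dvd n (Suc i))
           \<and> chain_density n \<ge> Delta A"
proof -
  obtain d where d: "Delta A = ereal d" "d > 0"
    using assms(2) Delta_le_3[of A] by (cases "Delta A") auto
  obtain w where w: "\<And>c. c < d \<Longrightarrow> \<exists>\<^sub>F k in sequentially. c < loglog_count {a\<in>A. 2 \<le> a \<and> hit w a} k"
    using exists_dense_hit_path[OF d(2,1)] by blast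
  define B where "B = {a\<in>A. 2 \<le> a \<and> hit w a}"
  have "infinite B"
    using infinite_if_frequently_loglog_count[of "d / 2" B] w[of "d / 2"] d by (simp add: B_def)
  then have mono: "strict_mono (enumerate B)" and mem: "\<And>i. enumerate B i \<in> B" and rng: "range (enumerate B) = B"
    by (auto simp: strict_mono_enumerate enumerate_in_set range_enumerate)
  have "enumerate B i dvd enumerate B (Suc i)" for i
    using mem[of i] mem[of "Suc i"] strict_monoD[OF mono, of i "Suc i"]
    by (intro hit_dvd[of w]) (auto simp: B_def)
  moreover have "Delta A \<le> chain_density (enumerate B)"
    unfolding d(1)
  \<comment> \<open>The trajectory exceeds only each c < d, so the bound at d is approached from
    below.\<close>
  proof (rule dense_le)
    fix y assume y: "y < ereal d"
    show "y \<le> chain_density (enumerate B)"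
    proof (cases y)
      case (real c)
      then show ?thesis
        using y w[of c] strict_mono_imp_inj_on[OF mono]
        by (auto simp: rng B_def[symmetric] intro!: chain_density_ge)
    qed (use y in auto)
  qed
  ultimately show ?thesis
    using mono mem by (intro exI[of _ "enumerate B"]) (auto simp: B_def)
qed

end
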